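(* Let $\mathcal{H}$ be a separable complex Hilbert space, and let $\{\varphi_\theta:\theta\in\Theta\}$ be a nontrivial family of vector states in $\mathcal{H}$. Let $T$ be a discrete statistic on $\mathcal{H}$, $$T=\sum_k\lambda_ke_k,$$ where $\{e_k\}$ is a countable partition of the identity into non-zero orthogonal projections and $\lambda_k\in\mathbb{R}$ are different eigenvalues of $T$, and assume that $T$ is weakly sufficient for $\{\varphi_\theta:\theta\in\Theta\}$. There exists a weakly sufficient statistic minimal with respect to $T$ if and only if for each $k$ $$\dim[\{e_k\varphi_\theta:\theta\in\Theta\}]=1.$$
   Context: For $\mathcal{K}\subset\mathcal{H}$, $[\mathcal{K}]$ denotes the smallest closed linear subspace of $\mathcal{H}$ containing $\mathcal{K}$. A vector state is a unit vector $\varphi\in\mathcal{H}$. A family of vector states is nontrivial if $\dim[\{\varphi_\theta:\theta\in\Theta\}]\geq2$. A version of a vector $\varphi$ is a vector $\widetilde{\varphi}=c\varphi$ with $c\in\mathbb{C}$, $|c|=1$. A (quantum) statistic is a (possibly unbounded) selfadjoint operator $T=\int_{-\infty}^{\infty}\lambda\,e(d\lambda)$ on $\mathcal{H}$, where $e$ is its spectral measure on the Borel sets of $\mathbb{R}$; for a Borel function $\Phi\colon\mathbb{R}\to\mathbb{R}$, $\Phi(T)=\int_{-\infty}^{\infty}\Phi(\lambda)\,e(d\lambda)$ (Borel functional calculus). A statistic $T$ is weakly sufficient for $\{\varphi_\theta:\theta\in\Theta\}$ if there exist Borel functions $\Phi_\theta\colon\mathbb{R}\to\mathbb{R}$ ($\theta\in\Theta$),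 a vector $\chi\in\mathcal{H}$ (which may be taken to be a unit vector; the normalization is inessential), and a version $\widetilde{\varphi}_\theta$ of $\varphi_\theta$ for each $\theta\in\Theta$, such that $\widetilde{\varphi}_\theta=\Phi_\theta(T)\chi$ for all $\theta\in\Theta$ (in particular $\chi$ lies in the domain of each $\Phi_\theta(T)$). Let $\mathcal{N}$ be the von Neumann algebra generated by $T$, i.e. the set of all $\Phi(T)$ with $\Phi$ a bounded complex-valued Borel function on $\mathbb{R}$. The statistics affiliated with $\mathcal{N}$ are the operators $\Phi(T)$ with $\Phi\colon\mathbb{R}\to\mathbb{R}$ Borel. Let $T$ be a statistic weakly sufficient for $\{\varphi_\theta:\theta\in\Theta\}$. A statistic $S$ weakly sufficient for $\{\varphi_\theta:\theta\in\Theta\}$ is minimal with respect to $T$ if for every statistic $U$ that is weakly sufficient for $\{\varphi_\theta:\theta\in\Theta\}$ and affiliated with the von Neumann algebra $\mathcal{N}$ generated by $T$, there is a real-valued Borel function $\Psi$ on $\mathbb{R}$ such that $S=\Psi(U)$. A known result (which may be assumed): a discrete statistic $T=\sum_k\lambda_ke_k$ (countable partition of the identity $\{e_k\}$, different eigenvalues $\lambda_k$) is weakly sufficient for $\{\varphi_\theta\}$ if and only if for each $k$ one has $\dim[\{e_k\varphi_\theta:\theta\in\Theta\}]\in\{0,1\}$, and there are versions $\widetilde{\varphi}_\theta$ of $\varphi_\theta$ such that $\langle e_k\widetilde{\varphi}_{\theta'},\widetilde{\varphi}_{\theta''}\rangle\in\mathbb{R}$ for all $k$ and all $\theta',\theta''\in\Theta$.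 *)

theory Defs
  imports "HOL-Analysis.Analysis"
begin

section \<open>Complex Hilbert spaces\<close>

class scaleC =
  fixes scaleC :: "complex \<Rightarrow> 'a \<Rightarrow> 'a" (infixr \<open>*\<^sub>C\<close> 75)

text \<open>
  The inner product is linear in its first argument. Its real part is the real inner product
  of the underlying real space, so that norm and topology are those of \<open>real_inner\<close>.
\<close>

class complex_inner = real_inner + scaleC +
  fixes cinner :: "'a \<Rightarrow> 'a \<Rightarrow> complex"
  assumes scaleC_add_right: "a *\<^sub>C (x + y) = a *\<^sub>C x + a *\<^sub>C y"
    and scaleC_add_left: "(a + b) *\<^sub>C x = a *\<^sub>C x + b *\<^sub>C x"
    and scaleC_scaleC: "a *\<^sub>C (b *\<^sub>C x) = (a * b) *\<^sub>C x"
    and scaleR_scaleC: "r *\<^sub>R x = complex_of_real r *\<^sub>C x"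
    and cinner_commute: "cinner x y = cnj (cinner y x)"
    and cinner_add_left: "cinner (x + y) z = cinner x z + cinner y z"
    and cinner_scaleC_left: "cinner (a *\<^sub>C x) y = a * cinner x y"
    and inner_eq_Re_cinner: "x \<bullet> y = Re (cinner x y)"

class chilbert_space = complex_inner + complete_space

global_interpretation complex_vector:
  vector_space "scaleC :: complex \<Rightarrow> 'a \<Rightarrow> 'a::complex_inner"
proof
  fix x :: 'a
  show "1 *\<^sub>C x = x"
    using scaleR_scaleC[of 1 x] by simp
qed (simp_all add: scaleC_add_right scaleC_add_left scaleC_scaleC)

definition ccspan :: "'a set \<Rightarrow> 'a::complex_inner set" where
  "ccspan S = \<Inter>{M. complex_vector.subspace M \<and> closed M \<and> S \<subseteq> M}"

text \<open>
  The complex dimension, with value \<open>\<infinity>\<close> for every infinite-dimensional space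
  (the library's \<open>dim\<close> is 0 there).
\<close>

definition cdim :: "'a::complex_inner set \<Rightarrow> enat" where
  "cdim M = (SUP B\<in>{B. B \<subseteq> M \<and> finite B \<and> complex_vector.independent B}. enat (card B))"


section \<open>Orthogonal projections and partitions of the identity\<close>

definition orthogonal_projection :: "('a \<Rightarrow> 'a::complex_inner) \<Rightarrow> bool" where
  "orthogonal_projection P \<longleftrightarrow>
     Vector_Spaces.linear scaleC scaleC P \<and>
     (\<forall>x. P (P x) = P x) \<and>
     (\<forall>x y. cinner (P x) y = cinner x (P y))"

definition partition_of_identity :: "'k set \<Rightarrow> ('k \<Rightarrow> 'a \<Rightarrow> 'a::complex_inner) \<Rightarrow> bool" where
  "partition_of_identity K e \<longleftrightarrow>
     countable K \<and>
     (\<forall>k\<in>K. orthogonal_projection (e k) \<and> (\<exists>x. e k x \<noteq> 0)) \<and>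
     (\<forall>j\<in>K. \<forall>k\<in>K. j \<noteq> k \<longrightarrow> (\<forall>x. e j (e k x) = 0)) \<and>
     (\<forall>x. ((\<lambda>k. e k x) has_sum x) K)"


section \<open>Unbounded selfadjoint operators\<close>

text \<open>
  A possibly unbounded operator is a partial function \<open>T\<close> with domain \<open>dom T\<close>. Equality of
  operators thus includes equality of their domains.
\<close>

definition linear_operator :: "('a \<rightharpoonup> 'a::complex_inner) \<Rightarrow> bool" where
  "linear_operator T \<longleftrightarrow>
     complex_vector.subspace (dom T) \<and>
     (\<forall>x\<in>dom T. \<forall>y\<in>dom T. the (T (x + y)) = the (T x) + the (T y)) \<and>
     (\<forall>c. \<forall>x\<in>dom T. the (T (c *\<^sub>C x)) = c *\<^sub>C the (T x))"

text \<open>The vector \<open>z\<close> below is unique when \<open>dom T\<close> is dense.\<close>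

definition operator_adjoint :: "('a \<rightharpoonup> 'a) \<Rightarrow> ('a \<rightharpoonup> 'a::complex_inner)" where
  "operator_adjoint T y =
     (if \<exists>z. \<forall>x\<in>dom T. cinner (the (T x)) y = cinner x z
      then Some (THE z. \<forall>x\<in>dom T. cinner (the (T x)) y = cinner x z)
      else None)"

definition selfadjoint :: "('a \<rightharpoonup> 'a::complex_inner) \<Rightarrow> bool" where
  "selfadjoint T \<longleftrightarrow> linear_operator T \<and> closure (dom T) = UNIV \<and> operator_adjoint T = T"

text \<open>
  The series is a norm-convergent one. Since the \<open>e k\<close> have orthogonal ranges, it converges for
  \<open>x\<close> if and only if the sum of all \<open>(l k)\<^sup>2 * (norm (e k x))\<^sup>2\<close> is finite.
\<close>

definition discrete_operator ::
    "'k set \<Rightarrow> ('k \<Rightarrow> real) \<Rightarrow> ('k \<Rightarrow> 'a \<Rightarrow> 'a) \<Rightarrow> ('a \<rightharpoonup> 'a::complex_inner)" where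
  "discrete_operator K l e x =
     (if (\<lambda>k. l k *\<^sub>R e k x) summable_on K
      then Some (\<Sum>\<^sub>\<infinity>k\<in>K. l k *\<^sub>R e k x)
      else None)"


section \<open>Spectral measures and Borel functional calculus\<close>

text \<open>Only the values of \<open>E\<close> on Borel sets are relevant.\<close>

definition spectral_measure :: "(real set \<Rightarrow> 'a \<Rightarrow> 'a::complex_inner) \<Rightarrow> bool" where
  "spectral_measure E \<longleftrightarrow>
     (\<forall>A\<in>sets borel. orthogonal_projection (E A)) \<and>
     (\<forall>x. E UNIV x = x) \<and>
     (\<forall>A\<in>sets borel. \<forall>B\<in>sets borel. \<forall>x. E (A \<inter> B) x = E A (E B x)) \<and>
     (\<forall>A :: nat \<Rightarrow> real set. range A \<subseteq> sets borel \<longrightarrow> disjoint_family A \<longrightarrow>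
        (\<forall>x. (\<lambda>n. E (A n) x) sums E (\<Union>n. A n) x))"

definition spectral_distribution ::
    "(real set \<Rightarrow> 'a \<Rightarrow> 'a) \<Rightarrow> 'a::complex_inner \<Rightarrow> real measure" where
  "spectral_distribution E x =
     measure_of UNIV (sets borel) (\<lambda>A. ennreal ((norm (E A x))\<^sup>2))"

text \<open>The integral of a function \<open>s\<close> with finitely many values.\<close>

definition simple_spectral_integral ::
    "(real set \<Rightarrow> 'a \<Rightarrow> 'a) \<Rightarrow> (real \<Rightarrow> real) \<Rightarrow> 'a \<Rightarrow> 'a::complex_inner" where
  "simple_spectral_integral E s x = (\<Sum>c\<in>range s. c *\<^sub>R E (s -` {c}) x)"

text \<open>
  For simple \<open>s\<close>, the squared norm of \<open>simple_spectral_integral E s x\<close> is the integral of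
  \<open>s\<^sup>2\<close> with respect to \<open>spectral_distribution E x\<close>. The integral of a square integrable \<open>f\<close> at
  \<open>x\<close> is therefore the common limit along all sequences of simple functions converging to \<open>f\<close>
  in \<open>L\<^sup>2\<close>; the domain of the integral is the set of \<open>x\<close> for which \<open>f\<close> is square integrable.
\<close>

definition spectral_integral ::
    "(real set \<Rightarrow> 'a \<Rightarrow> 'a) \<Rightarrow> (real \<Rightarrow> real) \<Rightarrow> ('a \<rightharpoonup> 'a::complex_inner)" where
  "spectral_integral E f x =
     (if (\<integral>\<^sup>+t. ennreal ((f t)\<^sup>2) \<partial>spectral_distribution E x) < \<infinity>
      then Some (THE y. \<forall>s :: nat \<Rightarrow> real \<Rightarrow> real.
             (\<forall>n. simple_function borel (s n)) \<longrightarrow>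
             (\<lambda>n. \<integral>\<^sup>+t. ennreal ((s n t - f t)\<^sup>2) \<partial>spectral_distribution E x) \<longlonglongrightarrow> 0 \<longrightarrow>
             (\<lambda>n. simple_spectral_integral E (s n) x) \<longlonglongrightarrow> y)
      else None)"

text \<open>
  By the spectral theorem a selfadjoint \<open>T\<close> on a Hilbert space has a spectral measure, and its
  values on Borel sets are unique. It is chosen by \<open>SOME\<close> because its values on other sets are
  arbitrary.
\<close>

definition spectral_measure_of :: "('a \<rightharpoonup> 'a) \<Rightarrow> real set \<Rightarrow> 'a \<Rightarrow> 'a::chilbert_space" where
  "spectral_measure_of T = (SOME E. spectral_measure E \<and> spectral_integral E (\<lambda>t. t) = T)"

definition borel_calculus :: "(real \<Rightarrow> real) \<Rightarrow> ('a \<rightharpoonup> 'a) \<Rightarrow> ('a \<rightharpoonup> 'a::chilbert_space)" where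
  "borel_calculus f T = spectral_integral (spectral_measure_of T) f"

text \<open>
  \<open>affiliated U T\<close> says that the selfadjoint operator \<open>U\<close> is affiliated with the von Neumann
  algebra generated by \<open>T\<close>, that is, that \<open>U\<close> is a real Borel function of \<open>T\<close>.
\<close>

definition affiliated :: "('a \<rightharpoonup> 'a) \<Rightarrow> ('a \<rightharpoonup> 'a::chilbert_space) \<Rightarrow> bool" where
  "affiliated U T \<longleftrightarrow> (\<exists>f\<in>borel_measurable borel. U = borel_calculus f T)"


section \<open>Families of vector states and weak sufficiency\<close>

definition vector_state :: "'a::complex_inner \<Rightarrow> bool" where
  "vector_state v \<longleftrightarrow> norm v = 1"

definition nontrivial_family :: "'i set \<Rightarrow> ('i \<Rightarrow> 'a::complex_inner) \<Rightarrow> bool" where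
  "nontrivial_family \<Theta> \<phi> \<longleftrightarrow> cdim (ccspan (\<phi> ` \<Theta>)) \<ge> 2"

definition is_version :: "'a::complex_inner \<Rightarrow> 'a \<Rightarrow> bool" where
  "is_version w v \<longleftrightarrow> (\<exists>c. cmod c = 1 \<and> w = c *\<^sub>C v)"

definition weakly_sufficient ::
    "('a \<rightharpoonup> 'a) \<Rightarrow> 'i set \<Rightarrow> ('i \<Rightarrow> 'a::chilbert_space) \<Rightarrow> bool" where
  "weakly_sufficient T \<Theta> \<phi> \<longleftrightarrow>
     selfadjoint T \<and>
     (\<exists>f v \<psi>. \<forall>\<theta>\<in>\<Theta>.
        f \<theta> \<in> borel_measurable borel \<and>
        is_version (\<psi> \<theta>) (\<phi> \<theta>) \<and>
        borel_calculus (f \<theta>) T v = Some (\<psi> \<theta>))"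

definition minimal_weakly_sufficient ::
    "('a \<rightharpoonup> 'a) \<Rightarrow> ('a \<rightharpoonup> 'a) \<Rightarrow> 'i set \<Rightarrow> ('i \<Rightarrow> 'a::chilbert_space) \<Rightarrow> bool" where
  "minimal_weakly_sufficient S T \<Theta> \<phi> \<longleftrightarrow>
     weakly_sufficient S \<Theta> \<phi> \<and>
     (\<forall>U. weakly_sufficient U \<Theta> \<phi> \<and> affiliated U T \<longrightarrow>
        (\<exists>g\<in>borel_measurable borel. S = borel_calculus g U))"

end

theory Submission
  imports Defs
begin

text \<open>
  An operator \<open>U = \<Sum>\<^sub>k m\<^sub>k e\<^sub>k\<close> satisfies \<open>\<Phi>(U) = \<Sum>\<^sub>k \<Phi>(m\<^sub>k) e\<^sub>k\<close>, so a statistic affiliated with \<open>T\<close> is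
  the same as a real sequence \<open>m\<close> on \<open>K\<close>, and it is weakly sufficient if and only if, for suitable
  versions, \<open>e\<^sub>k \<psi>\<^sub>\<theta> = a\<^sub>\<theta>(m\<^sub>k) e\<^sub>k v\<close> for all \<open>k\<close> and \<open>\<theta>\<close>. As \<open>T\<close> is affiliated with itself, a minimal
  statistic is also of this form.

  If \<open>e\<^sub>k \<phi>\<^sub>\<theta> = 0\<close> for some \<open>k\<close> and all \<open>\<theta>\<close>, then \<open>\<lambda>\<^sub>k\<close> can be identified with any other eigenvalue, so
  that a minimal statistic would be scalar and the family trivial. Otherwise, call \<open>j\<close> and \<open>k\<close>
  equivalent when the functions \<open>\<theta> \<mapsto> a\<^sub>\<theta>(\<lambda>\<^sub>j)\<close> and \<open>\<theta> \<mapsto> a\<^sub>\<theta>(\<lambda>\<^sub>k)\<close> are proportional. A weakly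
  sufficient statistic can identify only equivalent indices, and the statistic that identifies
  exactly those is weakly sufficient: let \<open>v\<close> have the component of \<open>2\<^sup>-\<^sup>n \<psi>\<^sub>\<theta>\<close> in the \<open>n\<close>-th class, for
  some \<open>\<theta> = \<theta>\<^sub>n\<close> at which the functions of that class do not vanish.
\<close>

instance chilbert_space \<subseteq> banach ..


section \<open>Complex inner product spaces\<close>

lemma cinner_scaleC_right: "cinner x (a *\<^sub>C y) = cnj a * cinner x (y::'a::complex_inner)"
  by (metis cinner_commute cinner_scaleC_left complex_cnj_mult)

lemma cinner_self: "cinner x x = complex_of_real ((norm (x::'a::complex_inner))\<^sup>2)"
proof -
  have "Im (cinner x x) = 0"
    using arg_cong[OF cinner_commute[of x x], of Im] by simp
  then show ?thesis
    by (simp add: complex_eq_iff dot_square_norm flip: inner_eq_Re_cinner)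
qed

lemma norm_scaleC: "norm (c *\<^sub>C (x::'a::complex_inner)) = cmod c * norm x"
proof -
  have "complex_of_real ((norm (c *\<^sub>C x))\<^sup>2) = complex_of_real ((cmod c * norm x)\<^sup>2)"
    unfolding cinner_self[symmetric] cinner_scaleC_left cinner_scaleC_right
    by (simp add: cinner_self power_mult_distrib complex_norm_square del: of_real_power)
  then have "(norm (c *\<^sub>C x))\<^sup>2 = (cmod c * norm x)\<^sup>2"
    using of_real_eq_iff by blast
  then show ?thesis
    by (simp add: power2_eq_iff_nonneg)
qed

text \<open>Conjugate linearity in the second argument turns the imaginary part into a real inner
  product, so boundedness of \<open>cinner\<close> in either argument reduces to that of the real
  inner product.\<close>

lemma cinner_eq_Complex: "cinner x (y::'a::complex_inner) = Complex (x \<bullet> y) (x \<bullet> (\<i> *\<^sub>C y))"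
  by (simp add: complex_eq_iff inner_eq_Re_cinner cinner_scaleC_right)

lemma scaleR_scaleC_commute: "c *\<^sub>C (r *\<^sub>R x) = r *\<^sub>R (c *\<^sub>C (x::'a::complex_inner))"
  by (simp add: scaleR_scaleC mult.commute)

lemma bounded_linear_cinner_left: "bounded_linear (\<lambda>x::'a::complex_inner. cinner x y)"
proof -
  have "bounded_linear (\<lambda>x. (x \<bullet> y) *\<^sub>R (1::complex) + (x \<bullet> (\<i> *\<^sub>C y)) *\<^sub>R \<i>)"
    by (intro bounded_linear_add bounded_linear_scaleR_const bounded_linear_inner_left)
  moreover have "(\<lambda>x. cinner x y) = (\<lambda>x. (x \<bullet> y) *\<^sub>R 1 + (x \<bullet> (\<i> *\<^sub>C y)) *\<^sub>R \<i>)"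
    by (auto simp: cinner_eq_Complex complex_eq_iff)
  ultimately show ?thesis by simp
qed

lemma bounded_linear_cinner_right: "bounded_linear (\<lambda>y::'a::complex_inner. cinner x y)"
proof -
  have "bounded_linear (\<lambda>y. cnj (cinner y x))"
    by (rule bounded_linear_compose[OF bounded_linear_cnj bounded_linear_cinner_left])
  then show ?thesis
    by (simp flip: cinner_commute)
qed

lemma cinner_eqI:
  assumes "\<And>w. cinner w x = cinner w (y::'a::complex_inner)"
  shows "x = y"
proof -
  have "cinner w x - cinner w y = 0" for w using assms by simp
  then have "w \<bullet> (x - y) = 0" for w
    by (metis assms inner_eq_Re_cinner cancel_comm_monoid_add_class.diff_cancel inner_diff_right)
  then show ?thesis
    by (metis inner_eq_zero_iff right_minus_eq)
qed

section \<open>Complex lines and dimension\<close>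

text \<open>For non-zero \<open>v\<close> the line is the set on which two continuous maps agree:
  \<open>x\<close> lies on it exactly when its orthogonal projection onto \<open>v\<close> is
  \<open>x\<close> itself. Both sides are multiplied by \<open>(norm v)\<^sup>2\<close> to avoid a
  division.\<close>

lemma closed_complex_line: "closed (range (\<lambda>c. c *\<^sub>C (v::'a::complex_inner)))"
proof (cases "v = 0")
  case False
  have eq: "cinner x v *\<^sub>C v = (norm v)\<^sup>2 *\<^sub>R x" if "x \<in> range (\<lambda>c. c *\<^sub>C v)" for x
    using that by (auto simp: cinner_scaleC_left cinner_self scaleR_scaleC mult.commute)
  have "range (\<lambda>c. c *\<^sub>C v) = {x. cinner x v *\<^sub>C v = (norm v)\<^sup>2 *\<^sub>R x}"
  proof (intro set_eqI iffI)
    fix x assume "x \<in> {x. cinner x v *\<^sub>C v = (norm v)\<^sup>2 *\<^sub>R x}"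
    then have "inverse ((norm v)\<^sup>2) *\<^sub>R (cinner x v *\<^sub>C v) = x"
      using False by simp
    then have "complex_of_real (inverse ((norm v)\<^sup>2)) *\<^sub>C cinner x v *\<^sub>C v = x"
      by (simp only: scaleR_scaleC)
    then show "x \<in> range (\<lambda>c. c *\<^sub>C v)"
      by (metis rangeI scaleC_scaleC)
  qed (use eq in blast)
  moreover have "closed {x. cinner x v *\<^sub>C v = (norm v)\<^sup>2 *\<^sub>R x}"
  proof (rule closed_Collect_eq)
    have "bounded_linear (\<lambda>c. c *\<^sub>C v)"
      by (rule bounded_linear_intro[of _ "norm v"])
         (simp_all add: scaleC_add_left norm_scaleC scaleR_scaleC scaleR_conv_of_real)
    then show "continuous_on UNIV (\<lambda>x. cinner x v *\<^sub>C v)"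
      using bounded_linear_compose[OF _ bounded_linear_cinner_left] linear_continuous_on by blast
  qed (intro continuous_intros)
  ultimately show ?thesis by simp
qed simp

lemma subspace_complex_line: "complex_vector.subspace (range (\<lambda>c. c *\<^sub>C (v::'a::complex_inner)))"
  using complex_vector.span_singleton[of v] complex_vector.subspace_span by metis

lemma ccspan_mono_line: "S \<subseteq> range (\<lambda>c. c *\<^sub>C v) \<Longrightarrow> ccspan S \<subseteq> range (\<lambda>c. c *\<^sub>C v)"
  unfolding ccspan_def using closed_complex_line subspace_complex_line by blast

lemma ccspan_superset: "S \<subseteq> ccspan S"
  by (auto simp: ccspan_def)

text \<open>The line is closed, so it contains the closed span, and independent sets inside the span
  of one vector have at most one element.\<close>

lemma cdim_ccspan_le_1:
  assumes "S \<subseteq> range (\<lambda>c. c *\<^sub>C v)"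
  shows "cdim (ccspan S) \<le> 1"
  unfolding cdim_def
proof (rule SUP_least)
  fix B assume "B \<in> {B. B \<subseteq> ccspan S \<and> finite B \<and> complex_vector.independent B}"
  then have "B \<subseteq> complex_vector.span {v}" "complex_vector.independent B"
    using ccspan_mono_line[OF assms] complex_vector.span_singleton[of v] by auto
  then have "card B \<le> card {v}"
    using complex_vector.independent_span_bound[of "{v}" B] by simp
  then show "enat (card B) \<le> 1"
    by (simp add: one_enat_def)
qed

lemma cdim_ccspan_ge_1:
  assumes "x \<in> S" "x \<noteq> 0"
  shows "cdim (ccspan S) \<ge> 1"
  unfolding cdim_def
proof (rule SUP_upper2)
  show "{x} \<in> {B. B \<subseteq> ccspan S \<and> finite B \<and> complex_vector.independent B}"
    using assms ccspan_superset[of S] by auto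
qed (simp add: one_enat_def)

lemma cdim_ccspan_zero:
  assumes "S \<subseteq> {0}"
  shows "cdim (ccspan S) = 0"
proof -
  have "ccspan S \<subseteq> {0}"
    using ccspan_mono_line[of S 0] assms by auto
  then have "B = {}" if "B \<subseteq> ccspan S" "complex_vector.independent B" for B
    using that complex_vector.dependent_zero by (metis empty_iff subset_singletonD subset_trans singletonI)
  then have "{B. B \<subseteq> ccspan S \<and> finite B \<and> complex_vector.independent B} \<subseteq> {{}}"
    by blast
  then have "cdim (ccspan S) \<le> 0"
    unfolding cdim_def by (intro SUP_least) (auto simp: zero_enat_def)
  then show ?thesis by simp
qed

text \<open>On a line the dimension is 0 or 1. This translates the dimension condition of the
  theorem into the existence of a non-zero component.\<close>

lemma cdim_ccspan_eq_1_iff: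
  assumes "S \<subseteq> range (\<lambda>c. c *\<^sub>C v)"
  shows "cdim (ccspan S) = 1 \<longleftrightarrow> (\<exists>x\<in>S. x \<noteq> 0)"
proof
  assume "cdim (ccspan S) = 1"
  then show "\<exists>x\<in>S. x \<noteq> 0"
    using cdim_ccspan_zero[of S] by (metis singletonI subsetI zero_neq_one)
qed (use cdim_ccspan_le_1[OF assms] cdim_ccspan_ge_1 in \<open>fastforce intro: antisym\<close>)


section \<open>Orthogonal projections\<close>

context
  fixes P :: "'a::complex_inner \<Rightarrow> 'a"
  assumes P: "orthogonal_projection P"
begin

lemma orthogonal_projection_idem: "P (P x) = P x"
  using P by (auto simp: orthogonal_projection_def)

lemma orthogonal_projection_selfadjoint: "cinner (P x) y = cinner x (P y)"
  using P by (auto simp: orthogonal_projection_def)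

lemma orthogonal_projection_inner: "P x \<bullet> y = x \<bullet> P y"
  using P by (auto simp: orthogonal_projection_def inner_eq_Re_cinner)

lemma orthogonal_projection_add: "P (x + y) = P x + P y"
  and orthogonal_projection_scaleC: "P (c *\<^sub>C x) = c *\<^sub>C P x"
  using P by (auto simp: orthogonal_projection_def Vector_Spaces.linear_iff)

lemma orthogonal_projection_scaleR: "P (r *\<^sub>R x) = r *\<^sub>R P x"
  by (simp add: scaleR_scaleC orthogonal_projection_scaleC)

lemma orthogonal_projection_norm: "(norm (P x))\<^sup>2 = P x \<bullet> x"
  by (metis dot_square_norm orthogonal_projection_idem orthogonal_projection_inner)

lemma orthogonal_projection_norm_le: "norm (P x) \<le> norm x"
proof -
  have "norm (P x) * norm (P x) \<le> norm (P x) * norm x"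
    using norm_cauchy_schwarz[of "P x" x] by (simp add: orthogonal_projection_norm flip: power2_eq_square)
  then show ?thesis
    by (metis mult_le_cancel_left norm_ge_zero norm_zero order.trans not_less order_le_less)
qed

lemma bounded_linear_orthogonal_projection: "bounded_linear P"
  by (rule bounded_linear_intro[of _ 1])
     (simp_all add: orthogonal_projection_add orthogonal_projection_scaleR orthogonal_projection_norm_le)

end


section \<open>Spectral measures\<close>

locale spectral =
  fixes E :: "real set \<Rightarrow> 'a::chilbert_space \<Rightarrow> 'a"
  assumes spectral_measure: "spectral_measure E"
begin

lemma orthogonal_projection: "A \<in> sets borel \<Longrightarrow> orthogonal_projection (E A)"
  and UNIV: "E UNIV x = x"
  and Int: "A \<in> sets borel \<Longrightarrow> B \<in> sets borel \<Longrightarrow> E (A \<inter> B) x = E A (E B x)"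
  and sums_UN: "range F \<subseteq> sets borel \<Longrightarrow> disjoint_family F \<Longrightarrow> (\<lambda>n. E (F n) x) sums E (\<Union>n. F n) x"
  using spectral_measure by (simp_all add: spectral_measure_def)

text \<open>The empty set is a disjoint union of infinitely many copies of itself, and the terms of
  a convergent series tend to 0.\<close>

lemma empty: "E {} x = 0"
proof -
  have "(\<lambda>n::nat. E {} x) sums E (\<Union>n::nat. {}) x"
    by (rule sums_UN) (auto simp: disjoint_family_on_def)
  then have "(\<lambda>n::nat. E {} x) \<longlonglongrightarrow> 0"
    by (metis summable_LIMSEQ_zero sums_summable)
  then show ?thesis
    by (simp add: LIMSEQ_const_iff)
qed

lemma Un_disjoint:
  assumes "A \<in> sets borel" "B \<in> sets borel" "A \<inter> B = {}"
  shows "E (A \<union> B) x = E A x + E B x"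
proof -
  have "(\<lambda>n. E (binaryset A B n) x) sums E (\<Union>n. binaryset A B n) x"
    using assms by (intro sums_UN) (auto simp: range_binaryset_eq disjoint_family_on_def binaryset_def)
  moreover have "(\<lambda>n. E (binaryset A B n) x) sums (\<Sum>n<2. E (binaryset A B n) x)"
    by (rule sums_finite) (auto simp: binaryset_def empty)
  ultimately show ?thesis
    using sums_unique2 by (fastforce simp: UN_binaryset_eq binaryset_def numeral_2_eq_2)
qed

lemma finite_UN:
  assumes "finite I" "\<And>i. i \<in> I \<Longrightarrow> A i \<in> sets borel" "disjoint_family_on A I"
  shows "E (\<Union>i\<in>I. A i) x = (\<Sum>i\<in>I. E (A i) x)"
  using assms
proof (induction I)
  case (insert i I)
  then have "E (A i \<union> (\<Union>i\<in>I. A i)) x = E (A i) x + E (\<Union>i\<in>I. A i) x"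
    by (intro Un_disjoint) (auto simp: disjoint_family_on_def)
  moreover have "disjoint_family_on A I"
    using insert.prems by (auto simp: disjoint_family_on_def)
  ultimately show ?case
    using insert by simp
qed (simp add: empty)

lemma orthogonal_disjoint:
  assumes "A \<in> sets borel" "B \<in> sets borel" "A \<inter> B = {}"
  shows "E A x \<bullet> E B x = 0"
  using assms Int[of A B x] orthogonal_projection_inner[OF orthogonal_projection, of A x "E B x"]
  by (simp add: empty)

section \<open>Scalar distributions of a spectral measure\<close>

abbreviation distribution :: "'a \<Rightarrow> real measure" where
  "distribution \<equiv> spectral_distribution E"

lemma space_distribution [simp]: "space (distribution x) = UNIV"
  and sets_distribution [measurable_cong, simp]: "sets (distribution x) = sets borel"
  by (simp_all add: spectral_distribution_def sets.sigma_sets_eq[of borel, simplified])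

text \<open>Since \<open>(norm (E A x))\<^sup>2\<close> equals \<open>E A x \<bullet> x\<close>,
  countable additivity is inherited from \<open>E\<close> through the bounded functional
  \<open>\<lambda>y. y \<bullet> x\<close>.\<close>

lemma emeasure_distribution:
  assumes "A \<in> sets borel"
  shows "emeasure (distribution x) A = ennreal ((norm (E A x))\<^sup>2)"
  unfolding spectral_distribution_def
proof (rule emeasure_measure_of_sigma)
  show "countably_additive (sets borel) (\<lambda>A. ennreal ((norm (E A x))\<^sup>2))"
  proof (rule countably_additiveI)
    fix A :: "nat \<Rightarrow> real set"
    assume A: "range A \<subseteq> sets borel" "disjoint_family A" "\<Union> (range A) \<in> sets borel"
    then have An: "A n \<in> sets borel" for n by auto
    have "(\<lambda>n. E (A n) x \<bullet> x) sums (E (\<Union>n. A n) x \<bullet> x)"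
      by (intro bounded_linear.sums[OF bounded_linear_inner_left] sums_UN A)
    then have "(\<lambda>n. (norm (E (A n) x))\<^sup>2) sums ((norm (E (\<Union>n. A n) x))\<^sup>2)"
      using A An by (simp add: orthogonal_projection_norm orthogonal_projection)
    then have "(\<lambda>n. ennreal ((norm (E (A n) x))\<^sup>2)) sums ennreal ((norm (E (\<Union>n. A n) x))\<^sup>2)"
      by (subst sums_ennreal) auto
    then show "(\<Sum>n. ennreal ((norm (E (A n) x))\<^sup>2)) = ennreal ((norm (E (\<Union> (range A)) x))\<^sup>2)"
      by (simp add: sums_unique[symmetric])
  qed
qed (use assms sets.sigma_algebra_axioms[of borel] in \<open>auto simp: positive_def empty\<close>)

section \<open>Integrals of simple functions and the isometry\<close>

text \<open>Finite additivity lets the integral be computed on any finer partition into level sets.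
  The values of \<open>h\<close> may have any type, so that pairs give a common refinement of two
  simple functions.\<close>

lemma simple_spectral_integral_comp:
  fixes h :: "real \<Rightarrow> 'b" and g :: "'b \<Rightarrow> real"
  assumes "simple_function borel h"
  shows "simple_spectral_integral E (\<lambda>t. g (h t)) x = (\<Sum>p\<in>range h. g p *\<^sub>R E (h -` {p}) x)"
proof -
  have fin: "finite (range h)" and meas: "h -` {p} \<in> sets borel" for p
    using assms simple_functionD[OF assms] by (simp_all add: simple_functionD(2))
  have "E ((\<lambda>t. g (h t)) -` {c}) x = (\<Sum>p\<in>{p \<in> range h. g p = c}. E (h -` {p}) x)" for c
  proof -
    have "(\<lambda>t. g (h t)) -` {c} = (\<Union>p\<in>{p \<in> range h. g p = c}. h -` {p})"
      by auto
    then show ?thesis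
      using finite_UN[of "{p \<in> range h. g p = c}" "\<lambda>p. h -` {p}" x] fin meas
      by (auto simp: disjoint_family_on_def)
  qed
  then have "simple_spectral_integral E (\<lambda>t. g (h t)) x =
      (\<Sum>c\<in>g ` range h. \<Sum>p\<in>{p \<in> range h. g p = c}. g p *\<^sub>R E (h -` {p}) x)"
    unfolding simple_spectral_integral_def
    by (intro sum.cong) (auto simp: scaleR_sum_right image_image)
  also have "\<dots> = (\<Sum>p\<in>range h. g p *\<^sub>R E (h -` {p}) x)"
    by (rule sum.image_gen[OF fin, symmetric])
  finally show ?thesis .
qed

lemma simple_spectral_integral_diff:
  assumes "simple_function borel s" "simple_function borel t"
  shows "simple_spectral_integral E (\<lambda>r. s r - t r) x =
         simple_spectral_integral E s x - simple_spectral_integral E t x"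
proof -
  note h = simple_function_Pair[OF assms]
  have "simple_spectral_integral E (\<lambda>r. fst (s r, t r)) x - simple_spectral_integral E (\<lambda>r. snd (s r, t r)) x =
        simple_spectral_integral E (\<lambda>r. fst (s r, t r) - snd (s r, t r)) x"
    using simple_spectral_integral_comp[OF h, of fst x] simple_spectral_integral_comp[OF h, of snd x]
      simple_spectral_integral_comp[OF h, of "\<lambda>p. fst p - snd p" x]
    by (simp add: scaleR_diff_left sum_subtractf)
  then show ?thesis by simp
qed

lemma simple_spectral_integral_const: "simple_spectral_integral E (\<lambda>_. c) x = c *\<^sub>R x"
  by (simp add: simple_spectral_integral_def vimage_def UNIV)

text \<open>Level sets are disjoint, so the summands are orthogonal and Pythagoras applies. This
  isometry carries convergence between \<open>L\<^sup>2\<close> and the Hilbert space.\<close>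

lemma norm_simple_spectral_integral:
  assumes s: "simple_function borel s"
  shows "ennreal ((norm (simple_spectral_integral E s x))\<^sup>2) = (\<integral>\<^sup>+t. ennreal ((s t)\<^sup>2) \<partial>distribution x)"
proof -
  have fin: "finite (range s)" and meas: "s -` {p} \<in> sets borel" for p
    using simple_functionD[OF s] by simp_all
  note [measurable] = borel_measurable_simple_function[OF s]
  have "(norm (simple_spectral_integral E s x))\<^sup>2 = (\<Sum>c\<in>range s. (norm (c *\<^sub>R E (s -` {c}) x))\<^sup>2)"
    unfolding simple_spectral_integral_def
    by (rule norm_sum_Pythagorean[OF fin])
       (auto simp: pairwise_def orthogonal_def meas intro!: orthogonal_disjoint)
  then have "ennreal ((norm (simple_spectral_integral E s x))\<^sup>2) =
      (\<Sum>c\<in>range s. ennreal (c\<^sup>2) * emeasure (distribution x) (s -` {c}))"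
    by (simp add: emeasure_distribution meas power_mult_distrib ennreal_mult flip: sum_ennreal)
  also have "\<dots> = (\<Sum>c\<in>range s. \<integral>\<^sup>+t. ennreal (c\<^sup>2) * indicator (s -` {c}) t \<partial>distribution x)"
    using meas by (intro sum.cong refl) (simp add: nn_integral_cmult_indicator)
  also have "\<dots> = (\<integral>\<^sup>+t. (\<Sum>c\<in>range s. ennreal (c\<^sup>2) * indicator (s -` {c}) t) \<partial>distribution x)"
    using meas by (intro nn_integral_sum[symmetric]) measurable
  also have "\<dots> = (\<integral>\<^sup>+t. ennreal ((s t)\<^sup>2) \<partial>distribution x)"
  proof (intro nn_integral_cong)
    fix t
    have "(\<Sum>c\<in>range s. ennreal (c\<^sup>2) * indicator (s -` {c}) t) = (\<Sum>c\<in>range s. if c = s t then ennreal (c\<^sup>2) else 0)"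
      by (intro sum.cong) (auto simp: indicator_def)
    then show "(\<Sum>c\<in>range s. ennreal (c\<^sup>2) * indicator (s -` {c}) t) = ennreal ((s t)\<^sup>2)"
      using fin by simp
  qed
  finally show ?thesis .
qed

text \<open>A substitute for the triangle inequality in \<open>L\<^sup>2\<close> that avoids square
  roots of extended reals.\<close>

lemma nn_integral_square_diff_le:
  assumes [measurable]: "f \<in> borel_measurable borel" "g \<in> borel_measurable borel" "h \<in> borel_measurable borel"
  shows "(\<integral>\<^sup>+t. ennreal ((f t - g t)\<^sup>2) \<partial>distribution x) \<le>
    2 * (\<integral>\<^sup>+t. ennreal ((f t - h t)\<^sup>2) \<partial>distribution x) + 2 * (\<integral>\<^sup>+t. ennreal ((g t - h t)\<^sup>2) \<partial>distribution x)"
proof -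
  \<comment> \<open>The right side minus the left side is the square of
    \<open>f t + g t - 2 * h t\<close>.\<close>
  have "(f t - g t)\<^sup>2 \<le> 2 * (f t - h t)\<^sup>2 + 2 * (g t - h t)\<^sup>2" for t
    using sum_squares_ge_zero[of "f t + g t - 2 * h t" 0] by (simp add: power2_eq_square algebra_simps)
  then have "ennreal ((f t - g t)\<^sup>2) \<le> 2 * ennreal ((f t - h t)\<^sup>2) + 2 * ennreal ((g t - h t)\<^sup>2)" for t
    by (simp add: ennreal_leI flip: ennreal_plus ennreal_numeral ennreal_mult)
  then have "(\<integral>\<^sup>+t. ennreal ((f t - g t)\<^sup>2) \<partial>distribution x) \<le>
    (\<integral>\<^sup>+t. 2 * ennreal ((f t - h t)\<^sup>2) + 2 * ennreal ((g t - h t)\<^sup>2) \<partial>distribution x)"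
    by (intro nn_integral_mono)
  also have "\<dots> = 2 * (\<integral>\<^sup>+t. ennreal ((f t - h t)\<^sup>2) \<partial>distribution x) + 2 * (\<integral>\<^sup>+t. ennreal ((g t - h t)\<^sup>2) \<partial>distribution x)"
    by (simp add: nn_integral_add nn_integral_cmult)
  finally show ?thesis .
qed

section \<open>Extension of the integral to square integrable functions\<close>

abbreviation L2_tendsto :: "'a \<Rightarrow> (nat \<Rightarrow> real \<Rightarrow> real) \<Rightarrow> (real \<Rightarrow> real) \<Rightarrow> bool" where
  "L2_tendsto x s f \<equiv> (\<lambda>n. \<integral>\<^sup>+t. ennreal ((s n t - f t)\<^sup>2) \<partial>distribution x) \<longlonglongrightarrow> 0"

text \<open>Simple approximations bounded by \<open>2 * \<bar>f t\<bar>\<close> have squared errors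
  below \<open>9 * (f t)\<^sup>2\<close>, and dominated convergence applies. Pointwise convergence
  is retained because discrete operators evaluate the approximations at single eigenvalues.\<close>

lemma simple_L2_dense:
  assumes [measurable]: "f \<in> borel_measurable borel"
    and fin: "(\<integral>\<^sup>+t. ennreal ((f t)\<^sup>2) \<partial>distribution x) < \<infinity>"
  obtains s where "\<And>n. simple_function borel (s n)" "\<And>t. (\<lambda>n. s n t) \<longlonglongrightarrow> f t" "L2_tendsto x s f"
proof -
  obtain s where s: "\<And>n. simple_function borel (s n)" "\<And>t. (\<lambda>n. s n t) \<longlonglongrightarrow> f t"
    "\<And>n t. dist (s n t) 0 \<le> 2 * dist (f t) 0"
    using borel_measurable_implies_sequence_metric[of f borel 0] by auto
  have [measurable]: "s n \<in> borel_measurable borel" for n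
    using s(1) by (rule borel_measurable_simple_function)
  have "(\<lambda>n. \<integral>\<^sup>+t. ennreal ((s n t - f t)\<^sup>2) \<partial>distribution x) \<longlonglongrightarrow> (\<integral>\<^sup>+t. 0 \<partial>distribution x)"
  proof (rule nn_integral_dominated_convergence[where w = "\<lambda>t. 9 * ennreal ((f t)\<^sup>2)"])
    have "\<bar>s n t - f t\<bar> \<le> 3 * \<bar>f t\<bar>" for n t
      using s(3)[of n t] by simp
    then have "(s n t - f t)\<^sup>2 \<le> 9 * (f t)\<^sup>2" for n t
      using power_mono[of "\<bar>s n t - f t\<bar>" "3 * \<bar>f t\<bar>" 2] by (simp add: power_mult_distrib)
    then show "AE t in distribution x. ennreal ((s n t - f t)\<^sup>2) \<le> 9 * ennreal ((f t)\<^sup>2)" for n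
      by (simp add: ennreal_leI flip: ennreal_numeral ennreal_mult)
    show "(\<integral>\<^sup>+t. 9 * ennreal ((f t)\<^sup>2) \<partial>distribution x) < \<infinity>"
      using fin by (simp add: nn_integral_cmult ennreal_mult_less_top)
    have "(\<lambda>n. (s n t - f t)\<^sup>2) \<longlonglongrightarrow> 0" for t
      using tendsto_power[OF tendsto_diff[OF s(2)[of t] tendsto_const[of "f t"]], of 2] by simp
    then have "(\<lambda>n. ennreal ((s n t - f t)\<^sup>2)) \<longlonglongrightarrow> 0" for t
      using tendsto_ennrealI by fastforce
    then show "AE t in distribution x. (\<lambda>n. ennreal ((s n t - f t)\<^sup>2)) \<longlonglongrightarrow> 0"
      by simp
  qed measurable
  then show ?thesis
    by (intro that[of s] s(1,2)) simp
qed

lemma ennreal_norm_simple_diff_le: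
  assumes "simple_function borel s" "simple_function borel t" "f \<in> borel_measurable borel"
  shows "ennreal ((norm (simple_spectral_integral E s x - simple_spectral_integral E t x))\<^sup>2) \<le>
    2 * (\<integral>\<^sup>+r. ennreal ((s r - f r)\<^sup>2) \<partial>distribution x) + 2 * (\<integral>\<^sup>+r. ennreal ((t r - f r)\<^sup>2) \<partial>distribution x)"
  using nn_integral_square_diff_le[of s t f x] assms
    norm_simple_spectral_integral[of "\<lambda>r. s r - t r" x] simple_spectral_integral_diff[of s t x]
  by (simp add: borel_measurable_simple_function)

text \<open>By the isometry an approximating sequence has Cauchy integrals, which converge by
  completeness; the integrals of any two such sequences differ by a null sequence, so one limit
  serves all.\<close>

lemma simple_spectral_integral_tendsto:
  assumes f: "f \<in> borel_measurable borel"
    and fin: "(\<integral>\<^sup>+t. ennreal ((f t)\<^sup>2) \<partial>distribution x) < \<infinity>"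
  shows "\<exists>y. \<forall>s. (\<forall>n. simple_function borel (s n)) \<longrightarrow> L2_tendsto x s f \<longrightarrow>
           (\<lambda>n. simple_spectral_integral E (s n) x) \<longlonglongrightarrow> y"
proof -
  obtain s where s: "\<And>n. simple_function borel (s n)" "\<And>t. (\<lambda>n. s n t) \<longlonglongrightarrow> f t" "L2_tendsto x s f"
    using simple_L2_dense[OF assms] by blast
  let ?I = "\<lambda>s. simple_spectral_integral E s x"
  have "Cauchy (\<lambda>n. ?I (s n))"
  proof (rule metric_CauchyI)
    fix \<epsilon> :: real assume "\<epsilon> > 0"
    \<comment> \<open>With both errors below \<open>\<epsilon>\<^sup>2 / 4\<close>, the bound with
      its two factors 2 stays below \<open>\<epsilon>\<^sup>2\<close>.\<close>
    then have "\<forall>\<^sub>F n in sequentially. (\<integral>\<^sup>+t. ennreal ((s n t - f t)\<^sup>2) \<partial>distribution x) < ennreal (\<epsilon>\<^sup>2 / 4)"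
      using s(3) by (intro order_tendstoD(2)) auto
    then obtain N where N: "\<And>n. n \<ge> N \<Longrightarrow> (\<integral>\<^sup>+t. ennreal ((s n t - f t)\<^sup>2) \<partial>distribution x) < ennreal (\<epsilon>\<^sup>2 / 4)"
      by (auto simp: eventually_sequentially)
    show "\<exists>N. \<forall>m\<ge>N. \<forall>n\<ge>N. dist (?I (s m)) (?I (s n)) < \<epsilon>"
    proof (intro exI allI impI)
      fix m n assume "m \<ge> N" "n \<ge> N"
      then have "2 * (\<integral>\<^sup>+t. ennreal ((s m t - f t)\<^sup>2) \<partial>distribution x) < 2 * ennreal (\<epsilon>\<^sup>2 / 4)"
        and "2 * (\<integral>\<^sup>+t. ennreal ((s n t - f t)\<^sup>2) \<partial>distribution x) < 2 * ennreal (\<epsilon>\<^sup>2 / 4)"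
        using N by (auto intro!: ennreal_mult_strict_left_mono)
      then have "2 * (\<integral>\<^sup>+t. ennreal ((s m t - f t)\<^sup>2) \<partial>distribution x) +
          2 * (\<integral>\<^sup>+t. ennreal ((s n t - f t)\<^sup>2) \<partial>distribution x) < 2 * ennreal (\<epsilon>\<^sup>2 / 4) + 2 * ennreal (\<epsilon>\<^sup>2 / 4)"
        by (rule add_strict_mono)
      also have "\<dots> = ennreal (\<epsilon>\<^sup>2)"
        by (simp flip: ennreal_numeral ennreal_mult ennreal_plus)
      finally have "ennreal ((norm (?I (s m) - ?I (s n)))\<^sup>2) < ennreal (\<epsilon>\<^sup>2)"
        using ennreal_norm_simple_diff_le[OF s(1) s(1) f] by (rule le_less_trans[rotated])
      then have "(norm (?I (s m) - ?I (s n)))\<^sup>2 < \<epsilon>\<^sup>2"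
        by (simp add: ennreal_less_iff)
      then show "dist (?I (s m)) (?I (s n)) < \<epsilon>"
        using \<open>\<epsilon> > 0\<close> by (simp add: dist_norm power_less_imp_less_base)
    qed
  qed
  then obtain y where y: "(\<lambda>n. ?I (s n)) \<longlonglongrightarrow> y"
    using Cauchy_convergent convergent_def by blast
  have "(\<lambda>n. ?I (t n)) \<longlonglongrightarrow> y" if t: "\<forall>n. simple_function borel (t n)" "L2_tendsto x t f" for t
  proof -
    have "(\<lambda>n. 2 * (\<integral>\<^sup>+r. ennreal ((t n r - f r)\<^sup>2) \<partial>distribution x) +
        2 * (\<integral>\<^sup>+r. ennreal ((s n r - f r)\<^sup>2) \<partial>distribution x)) \<longlonglongrightarrow> 2 * 0 + 2 * 0"
      by (intro tendsto_add tendsto_mult_ennreal tendsto_const t s(3)) auto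
    then have lim: "(\<lambda>n. 2 * (\<integral>\<^sup>+r. ennreal ((t n r - f r)\<^sup>2) \<partial>distribution x) +
        2 * (\<integral>\<^sup>+r. ennreal ((s n r - f r)\<^sup>2) \<partial>distribution x)) \<longlonglongrightarrow> ennreal 0"
      by simp
    have "(\<lambda>n. ennreal ((norm (?I (t n) - ?I (s n)))\<^sup>2)) \<longlonglongrightarrow> ennreal 0"
    proof (rule tendsto_sandwich[OF _ _ tendsto_const lim])
      show "\<forall>\<^sub>F n in sequentially. ennreal 0 \<le> ennreal ((norm (?I (t n) - ?I (s n)))\<^sup>2)"
        by simp
    qed (intro always_eventually allI ennreal_norm_simple_diff_le t(1)[rule_format] s(1) f)
    then have "(\<lambda>n. (norm (?I (t n) - ?I (s n)))\<^sup>2) \<longlonglongrightarrow> 0"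
      by (subst (asm) tendsto_ennreal_iff) auto
    then have "(\<lambda>n. ?I (t n) - ?I (s n)) \<longlonglongrightarrow> 0"
      using tendsto_real_sqrt[of "\<lambda>n. (norm (?I (t n) - ?I (s n)))\<^sup>2" 0] by (simp add: tendsto_norm_zero_iff)
    then show ?thesis
      using tendsto_add[OF _ y] by fastforce
  qed
  then show ?thesis by blast
qed

text \<open>The description in \<open>spectral_integral\<close> is proper: a limit exists, and it is
  unique because at least one approximating sequence exists.\<close>

lemma spectral_integral_eq_Some:
  assumes f: "f \<in> borel_measurable borel"
    and fin: "(\<integral>\<^sup>+t. ennreal ((f t)\<^sup>2) \<partial>distribution x) < \<infinity>"
  obtains y where "spectral_integral E f x = Some y"
    "\<And>s. (\<And>n. simple_function borel (s n)) \<Longrightarrow> L2_tendsto x s f \<Longrightarrow>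
       (\<lambda>n. simple_spectral_integral E (s n) x) \<longlonglongrightarrow> y"
proof -
  obtain y where y: "\<forall>s. (\<forall>n. simple_function borel (s n)) \<longrightarrow> L2_tendsto x s f \<longrightarrow>
       (\<lambda>n. simple_spectral_integral E (s n) x) \<longlonglongrightarrow> y"
    using simple_spectral_integral_tendsto[OF assms] by blast
  obtain s where s: "\<And>n. simple_function borel (s n)" "\<And>t. (\<lambda>n. s n t) \<longlonglongrightarrow> f t" "L2_tendsto x s f"
    using simple_L2_dense[OF assms] by blast
  have "spectral_integral E f x = Some y"
    unfolding spectral_integral_def if_P[OF fin] option.inject
  proof (rule the_equality)
    fix z
    assume "\<forall>s. (\<forall>n. simple_function borel (s n)) \<longrightarrow> L2_tendsto x s f \<longrightarrow>
       (\<lambda>n. simple_spectral_integral E (s n) x) \<longlonglongrightarrow> z"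
    then show "z = y"
      using s(1,3) y LIMSEQ_unique by blast
  qed (fact y)
  then show ?thesis
    using that y by blast
qed

lemma spectral_integral_eq_None:
  "\<not> (\<integral>\<^sup>+t. ennreal ((f t)\<^sup>2) \<partial>distribution x) < \<infinity> \<Longrightarrow> spectral_integral E f x = None"
  by (simp add: spectral_integral_def)

text \<open>Simple functions approximating the identity have integrals tending to
  \<open>\<mu> *\<^sub>R x\<close>, so by the isometry they also tend to the constant
  \<open>\<mu>\<close> in \<open>L\<^sup>2\<close>. Hence the identity equals \<open>\<mu>\<close>
  almost everywhere for the distribution of \<open>x\<close>, which is therefore concentrated at
  \<open>\<mu>\<close>.\<close>

lemma eigenvector:
  assumes x: "spectral_integral E (\<lambda>t. t) x = Some (\<mu> *\<^sub>R x)"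
  shows "E {\<mu>} x = x"
proof -
  have fin: "(\<integral>\<^sup>+t. ennreal (t\<^sup>2) \<partial>distribution x) < \<infinity>"
    using x spectral_integral_eq_None[where f = "\<lambda>t. t" and x = x] by fastforce
  obtain y where y: "spectral_integral E (\<lambda>t. t) x = Some y"
    "\<And>s. (\<And>n. simple_function borel (s n)) \<Longrightarrow> L2_tendsto x s (\<lambda>t. t) \<Longrightarrow>
       (\<lambda>n. simple_spectral_integral E (s n) x) \<longlonglongrightarrow> y"
    using spectral_integral_eq_Some[where f = "\<lambda>t. t" and x = x] fin by auto
  obtain s where s: "\<And>n. simple_function borel (s n)" "\<And>t. (\<lambda>n. s n t) \<longlonglongrightarrow> t" "L2_tendsto x s (\<lambda>t. t)"
    using simple_L2_dense[where f = "\<lambda>t. t" and x = x] fin by auto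
  have [measurable]: "s n \<in> borel_measurable borel" for n
    using s(1) by (rule borel_measurable_simple_function)
  have "(\<lambda>n. simple_spectral_integral E (s n) x) \<longlonglongrightarrow> \<mu> *\<^sub>R x"
    using y(2)[OF s(1,3)] y(1) x by simp
  then have "(\<lambda>n. simple_spectral_integral E (\<lambda>t. s n t - \<mu>) x) \<longlonglongrightarrow> 0"
    using s(1) by (simp add: simple_spectral_integral_diff simple_spectral_integral_const LIM_zero)
  then have "(\<lambda>n. ennreal ((norm (simple_spectral_integral E (\<lambda>t. s n t - \<mu>) x))\<^sup>2)) \<longlonglongrightarrow> ennreal (0\<^sup>2)"
    by (intro tendsto_ennrealI tendsto_power tendsto_norm_zero)
  then have lim: "(\<lambda>n. \<integral>\<^sup>+t. ennreal ((s n t - \<mu>)\<^sup>2) \<partial>distribution x) \<longlonglongrightarrow> 0"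
    using s(1) by (simp add: norm_simple_spectral_integral)
  have "(\<lambda>n. 2 * (\<integral>\<^sup>+t. ennreal ((t - s n t)\<^sup>2) \<partial>distribution x) +
        2 * (\<integral>\<^sup>+t. ennreal ((\<mu> - s n t)\<^sup>2) \<partial>distribution x)) \<longlonglongrightarrow> 2 * 0 + 2 * 0"
    using s(3) lim by (intro tendsto_add tendsto_mult_ennreal tendsto_const) (auto simp: power2_commute)
  then have "(\<integral>\<^sup>+t. ennreal ((t - \<mu>)\<^sup>2) \<partial>distribution x) \<le> 2 * 0 + 2 * 0"
    by (rule LIMSEQ_le_const) (auto intro!: nn_integral_square_diff_le)
  then have "(\<integral>\<^sup>+t. ennreal ((t - \<mu>)\<^sup>2) \<partial>distribution x) = 0"
    by simp
  then have "AE t in distribution x. ennreal ((t - \<mu>)\<^sup>2) = 0"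
    by (subst (asm) nn_integral_0_iff_AE) auto
  then have "AE t in distribution x. t \<in> {\<mu>}"
    by (rule AE_mp) (auto simp: ennreal_eq_0_iff)
  then have "emeasure (distribution x) (UNIV - {\<mu>}) = 0"
    by (subst (asm) AE_iff_measurable[where N = "UNIV - {\<mu>}"]) auto
  then have "E (UNIV - {\<mu>}) x = 0"
    by (simp add: emeasure_distribution)
  moreover have "E ({\<mu>} \<union> (UNIV - {\<mu>})) x = E {\<mu>} x + E (UNIV - {\<mu>}) x"
    by (rule Un_disjoint) auto
  ultimately show ?thesis
    by (simp add: UNIV)
qed

end


section \<open>Discrete operators\<close>

locale identity_partition =
  fixes K :: "'k set" and e :: "'k \<Rightarrow> 'a::chilbert_space \<Rightarrow> 'a"
  assumes partition: "partition_of_identity K e"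
begin

lemma countable_K: "countable K"
  and orthogonal_projection_e: "k \<in> K \<Longrightarrow> orthogonal_projection (e k)"
  and ex_nonzero: "k \<in> K \<Longrightarrow> \<exists>x. e k x \<noteq> 0"
  and has_sum_e: "((\<lambda>k. e k x) has_sum x) K"
  using partition by (simp_all add: partition_of_identity_def)

lemma e_e: "j \<in> K \<Longrightarrow> k \<in> K \<Longrightarrow> e j (e k x) = (if j = k then e k x else 0)"
  using partition orthogonal_projection_idem[OF orthogonal_projection_e]
  by (auto simp: partition_of_identity_def)

lemma bounded_linear_e: "k \<in> K \<Longrightarrow> bounded_linear (e k)"
  by (intro bounded_linear_orthogonal_projection orthogonal_projection_e)

lemma e_scaleR: "k \<in> K \<Longrightarrow> e k (r *\<^sub>R x) = r *\<^sub>R e k x"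
  and e_scaleC: "k \<in> K \<Longrightarrow> e k (c *\<^sub>C x) = c *\<^sub>C e k x"
  and e_add: "k \<in> K \<Longrightarrow> e k (x + y) = e k x + e k y"
  by (simp_all add: orthogonal_projection_scaleR orthogonal_projection_scaleC orthogonal_projection_add
      orthogonal_projection_e)

section \<open>Componentwise description of vectors and operators\<close>

lemma eqI: "(\<And>k. k \<in> K \<Longrightarrow> e k x = e k y) \<Longrightarrow> x = y"
  using has_sum_e[of x] has_sum_e[of y] has_sum_cong[of K "\<lambda>k. e k x" "\<lambda>k. e k y"] has_sum_unique by metis

text \<open>Convergence is replaced by the existence of a vector with prescribed components. In one
  direction \<open>e k\<close> is applied termwise and orthogonality leaves one term; in the other,
  the series is the expansion of \<open>y\<close> itself.\<close>

lemma has_sum_scaled_iff: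
  "((\<lambda>k. c k *\<^sub>R e k x) has_sum y) K \<longleftrightarrow> (\<forall>k\<in>K. e k y = c k *\<^sub>R e k x)"
proof
  assume sum: "((\<lambda>k. c k *\<^sub>R e k x) has_sum y) K"
  show "\<forall>k\<in>K. e k y = c k *\<^sub>R e k x"
  proof
    fix k assume k: "k \<in> K"
    have "((\<lambda>j. e k (c j *\<^sub>R e j x)) has_sum e k y) K"
      by (rule has_sum_bounded_linear[OF bounded_linear_e[OF k] sum])
    moreover have "((\<lambda>j. e k (c j *\<^sub>R e j x)) has_sum c k *\<^sub>R e k x) K"
      using k by (intro has_sum_finite_neutralI[of "{k}"]) (auto simp: e_scaleR e_e)
    ultimately show "e k y = c k *\<^sub>R e k x"
      by (rule has_sum_unique)
  qed
next
  assume "\<forall>k\<in>K. e k y = c k *\<^sub>R e k x"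
  then show "((\<lambda>k. c k *\<^sub>R e k x) has_sum y) K"
    using has_sum_e[of y] by (simp cong: has_sum_cong)
qed

lemma discrete_operator_eq_Some_iff:
  "discrete_operator K m e x = Some y \<longleftrightarrow> (\<forall>k\<in>K. e k y = m k *\<^sub>R e k x)"
  unfolding has_sum_scaled_iff[symmetric] discrete_operator_def
  by (auto simp: has_sum_infsum infsumI dest: has_sum_imp_summable)

lemma discrete_operator_e: "k \<in> K \<Longrightarrow> discrete_operator K m e (e k x) = Some (m k *\<^sub>R e k x)"
  by (simp add: discrete_operator_eq_Some_iff e_scaleR e_e)

lemma discrete_operator_cong:
  "(\<And>k. k \<in> K \<Longrightarrow> m k = m' k) \<Longrightarrow> discrete_operator K m e = discrete_operator K m' e"
  by (intro ext option.expand) (auto simp: discrete_operator_def cong: summable_on_cong infsum_cong)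

text \<open>The range of \<open>e k\<close> contains a non-zero eigenvector, from which the
  eigenvalue can be read off.\<close>

lemma discrete_operator_inject:
  assumes "discrete_operator K m e = discrete_operator K m' e" "k \<in> K"
  shows "m k = m' k"
proof -
  obtain x where "e k x \<noteq> 0" using ex_nonzero[OF assms(2)] by blast
  then show ?thesis
    using discrete_operator_e[OF assms(2), of m x] discrete_operator_e[OF assms(2), of m' x] assms(1) by simp
qed

text \<open>Real multipliers pass through both arguments of the inner product without conjugation.
  This gives the symmetry of discrete operators and of the projections
  \<open>proj J\<close>.\<close>

lemma cinner_scaled_eq:
  assumes "\<And>k. k \<in> K \<Longrightarrow> e k x' = c k *\<^sub>R e k x" "\<And>k. k \<in> K \<Longrightarrow> e k y' = c k *\<^sub>R e k y"
  shows "cinner x' y = cinner x y'"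
proof -
  have 1: "((\<lambda>k. cinner (e k x') y) has_sum cinner x' y) K"
    and 2: "((\<lambda>k. cinner x (e k y')) has_sum cinner x y') K"
    by (intro has_sum_bounded_linear[OF bounded_linear_cinner_left] has_sum_e
        has_sum_bounded_linear[OF bounded_linear_cinner_right])+
  have "cinner (e k x') y = cinner x (e k y')" if "k \<in> K" for k
    using that assms by (simp add: scaleR_scaleC cinner_scaleC_left cinner_scaleC_right
        orthogonal_projection_selfadjoint orthogonal_projection_e)
  then have "((\<lambda>k. cinner (e k x') y) has_sum cinner x y') K"
    using 2 by (simp cong: has_sum_cong)
  with 1 show ?thesis
    by (rule has_sum_unique)
qed

lemma has_sum_norm_power2: "((\<lambda>k. (norm (e k x))\<^sup>2) has_sum (norm x)\<^sup>2) K"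
proof -
  have "((\<lambda>k. e k x \<bullet> x) has_sum (norm x)\<^sup>2) K"
    unfolding dot_square_norm[symmetric]
    by (intro has_sum_bounded_linear[OF bounded_linear_inner_left] has_sum_e)
  moreover have "e k x \<bullet> x = (norm (e k x))\<^sup>2" if "k \<in> K" for k
    using that by (simp add: orthogonal_projection_norm orthogonal_projection_e)
  ultimately show ?thesis
    by (simp cong: has_sum_cong)
qed

text \<open>Parseval's identity, compared term by term.\<close>

lemma norm_leI:
  assumes "\<And>k. k \<in> K \<Longrightarrow> norm (e k x) \<le> norm (e k y)"
  shows "norm x \<le> norm y"
proof -
  have "(norm x)\<^sup>2 \<le> (norm y)\<^sup>2"
    by (rule has_sum_mono[OF has_sum_norm_power2 has_sum_norm_power2]) (rule power_mono[OF assms norm_ge_zero])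
  then show ?thesis by simp
qed

text \<open>The domain is dense because it contains the finite partial sums of every expansion. The
  adjoint relation, tested on the range of each \<open>e k\<close>, fixes every component of the
  image.\<close>

lemma selfadjoint_discrete_operator: "selfadjoint (discrete_operator K m e)"
  unfolding selfadjoint_def
proof (intro conjI)
  let ?D = "discrete_operator K m e"
  note Some = discrete_operator_eq_Some_iff[of m]
  have zero: "?D 0 = Some 0"
    by (simp add: Some linear_0[OF bounded_linear.linear[OF bounded_linear_e]])
  have add: "?D (x + y) = Some (x' + y')" if "?D x = Some x'" "?D y = Some y'" for x x' y y'
    using that by (simp add: Some e_add scaleR_add_right)
  have scale: "?D (c *\<^sub>C x) = Some (c *\<^sub>C x')" if "?D x = Some x'" for c x x'
    using that by (simp add: Some e_scaleC scaleR_scaleC_commute)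
  have sub: "complex_vector.subspace (dom ?D)"
    unfolding complex_vector.subspace_def by (auto simp: zero dest: add scale)
  then show "linear_operator ?D"
    unfolding linear_operator_def by (auto simp: add scale)
  have fin: "(\<Sum>k\<in>F. e k x) \<in> dom ?D" if "finite F" "F \<subseteq> K" for F x
    using that by (intro complex_vector.subspace_sum[OF sub]) (use discrete_operator_e[of _ m] in blast)
  show "closure (dom ?D) = UNIV"
  proof (intro equalityI subset_UNIV subsetI)
    fix x
    have lim: "((\<lambda>F. \<Sum>k\<in>F. e k x) \<longlongrightarrow> x) (finite_subsets_at_top K)"
      using has_sum_e by (simp add: has_sum_def)
    have "\<forall>\<^sub>F F in finite_subsets_at_top K. (\<Sum>k\<in>F. e k x) \<in> closure (dom ?D)"
      using fin by (intro eventually_finite_subsets_at_top_weakI subsetD[OF closure_subset])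
    then show "x \<in> closure (dom ?D)"
      by (rule Lim_in_closed_set[OF closed_closure _ finite_subsets_at_top_neq_bot lim])
  qed
  show "operator_adjoint ?D = ?D"
  proof
    fix y
    \<comment> \<open>This settles existence and uniqueness in \<open>operator_adjoint\<close>
      together.\<close>
    have iff: "(\<forall>x\<in>dom ?D. cinner (the (?D x)) y = cinner x z) \<longleftrightarrow> ?D y = Some z" for z
    proof
      assume adj: "\<forall>x\<in>dom ?D. cinner (the (?D x)) y = cinner x z"
      have "e k z = m k *\<^sub>R e k y" if k: "k \<in> K" for k
      proof (rule cinner_eqI)
        fix w
        have "cinner (m k *\<^sub>R e k w) y = cinner (e k w) z"
          using adj discrete_operator_e[OF k, of m w] by force
        then show "cinner w (e k z) = cinner w (m k *\<^sub>R e k y)"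
          using orthogonal_projection_selfadjoint[OF orthogonal_projection_e[OF k]]
          by (simp add: scaleR_scaleC cinner_scaleC_left cinner_scaleC_right)
      qed
      then show "?D y = Some z"
        by (simp add: Some)
    next
      assume "?D y = Some z"
      then have "cinner x' y = cinner x z" if "?D x = Some x'" for x x'
        using that by (intro cinner_scaled_eq[of _ m]) (simp_all add: Some)
      then show "\<forall>x\<in>dom ?D. cinner (the (?D x)) y = cinner x z"
        by auto
    qed
    show "operator_adjoint ?D y = ?D y"
      unfolding operator_adjoint_def iff by (cases "?D y") auto
  qed
qed

section \<open>Spectral measure and functional calculus of a discrete operator\<close>

text \<open>The projection onto the closed sum of the ranges with index in \<open>J\<close>. Writing
  it with an indicator keeps \<open>K\<close> as index set, so that
  \<open>has_sum_scaled_iff\<close> applies.\<close>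

definition proj :: "'k set \<Rightarrow> 'a \<Rightarrow> 'a" where
  "proj J x = (\<Sum>\<^sub>\<infinity>k\<in>K. indicator J k *\<^sub>R e k x)"

lemma has_sum_proj: "((\<lambda>k. e k x) has_sum proj J x) (K \<inter> J)"
  and e_proj: "k \<in> K \<Longrightarrow> e k (proj J x) = indicator J k *\<^sub>R e k x"
proof -
  have "(\<lambda>k. e k x) summable_on K \<inter> J"
    using has_sum_e summable_on_def by (intro summable_on_subset_banach[of _ K "K \<inter> J"]) blast+
  then obtain y where y: "((\<lambda>k. e k x) has_sum y) (K \<inter> J)"
    by (auto simp: summable_on_def)
  also have "?this \<longleftrightarrow> ((\<lambda>k. indicator J k *\<^sub>R e k x) has_sum y) K"
    by (rule has_sum_cong_neutral) (auto simp: indicator_def)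
  finally have sum: "((\<lambda>k. indicator J k *\<^sub>R e k x) has_sum y) K" .
  then have "proj J x = y"
    by (simp add: proj_def infsumI)
  then show "((\<lambda>k. e k x) has_sum proj J x) (K \<inter> J)" "k \<in> K \<Longrightarrow> e k (proj J x) = indicator J k *\<^sub>R e k x"
    using y sum by (auto simp: has_sum_scaled_iff)
qed

lemma orthogonal_projection_proj: "orthogonal_projection (proj J)"
  unfolding orthogonal_projection_def
proof (intro conjI allI)
  show "Vector_Spaces.linear scaleC scaleC (proj J)"
    unfolding Vector_Spaces.linear_iff
  proof (intro conjI allI complex_vector.vector_space_axioms)
    show "proj J (x + y) = proj J x + proj J y" for x y
      by (rule eqI) (simp add: e_proj e_add scaleR_add_right)
    show "proj J (c *\<^sub>C x) = c *\<^sub>C proj J x" for c x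
      by (rule eqI) (simp add: e_proj e_scaleC scaleR_scaleC_commute)
  qed
  show "proj J (proj J x) = proj J x" for x
    by (rule eqI) (simp add: e_proj indicator_def)
  show "cinner (proj J x) y = cinner x (proj J y)" for x y
    by (rule cinner_scaled_eq[of _ "indicator J"]) (simp_all add: e_proj)
qed

lemma spectral_measure_proj: "spectral_measure (\<lambda>A. proj (m -` A))"
  unfolding spectral_measure_def
proof (intro conjI ballI allI impI orthogonal_projection_proj)
  show "proj (m -` UNIV) x = x" for x
    by (rule eqI) (simp add: e_proj)
  show "proj (m -` (A \<inter> B)) x = proj (m -` A) (proj (m -` B) x)" for A B x
    by (rule eqI) (simp add: e_proj indicator_def)
  fix A :: "nat \<Rightarrow> real set" and x
  assume "disjoint_family A"
  then have disj: "i = j" if "t \<in> A i" "t \<in> A j" for i j t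
    using that by (auto simp: disjoint_family_on_def)
  \<comment> \<open>Pairing each index with the unique set that contains its eigenvalue makes
    countable additivity a regrouping of one unordered sum.\<close>
  let ?S = "SIGMA n:UNIV. K \<inter> m -` A n"
  have "snd ` ?S = K \<inter> m -` (\<Union>n. A n)"
    by force
  then have "((\<lambda>k. e k x) has_sum proj (m -` (\<Union>n. A n)) x) (snd ` ?S)"
    using has_sum_proj by simp
  moreover have "inj_on snd ?S"
    using disj by (auto simp: inj_on_def)
  ultimately have "((\<lambda>(n, k). e k x) has_sum proj (m -` (\<Union>n. A n)) x) ?S"
    by (simp add: has_sum_reindex o_def case_prod_beta')
  then have "((\<lambda>n. proj (m -` A n) x) has_sum proj (m -` (\<Union>n. A n)) x) UNIV"
    using has_sum_proj by (elim has_sum_Sigma[OF isUCont_plus]) auto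
  then show "(\<lambda>n. proj (m -` A n) x) sums proj (m -` (\<Union>n. A n)) x"
    by (rule has_sum_imp_sums)
qed

text \<open>On the \<open>k\<close>-th component a simple integral multiplies by
  \<open>s (m k)\<close>, and limits preserve this. \<open>E\<close> is prescribed on Borel sets
  only, so that the measure chosen by \<open>spectral_measure_of\<close> is covered.\<close>

lemma spectral_integral_proj:
  assumes E: "spectral_measure E" and E_eq: "\<And>A x. A \<in> sets borel \<Longrightarrow> E A x = proj (m -` A) x"
    and f[measurable]: "f \<in> borel_measurable borel"
  shows "spectral_integral E f = discrete_operator K (f \<circ> m) e"
proof
  fix x
  interpret spectral E using E by unfold_locales
  have e_simple: "e k (simple_spectral_integral E s x) = s (m k) *\<^sub>R e k x"
    if s: "simple_function borel s" and k: "k \<in> K" for s k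
  proof -
    have "e k (simple_spectral_integral E s x) = (\<Sum>c\<in>range s. c *\<^sub>R e k (E (s -` {c}) x))"
      by (simp add: simple_spectral_integral_def e_scaleR k
          linear_sum[OF bounded_linear.linear[OF bounded_linear_e[OF k]]])
    also have "\<dots> = (\<Sum>c\<in>range s. if c = s (m k) then s (m k) *\<^sub>R e k x else 0)"
      using simple_functionD(2)[OF s] by (intro sum.cong) (auto simp: E_eq e_proj k indicator_def)
    finally show ?thesis
      using simple_functionD(1)[OF s] by simp
  qed
  show "spectral_integral E f x = discrete_operator K (f \<circ> m) e x"
  proof (cases "(\<integral>\<^sup>+t. ennreal ((f t)\<^sup>2) \<partial>distribution x) < \<infinity>")
    case True
    obtain y where y: "spectral_integral E f x = Some y"
      "\<And>s. (\<And>n. simple_function borel (s n)) \<Longrightarrow> L2_tendsto x s f \<Longrightarrow>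
         (\<lambda>n. simple_spectral_integral E (s n) x) \<longlonglongrightarrow> y"
      using spectral_integral_eq_Some[OF f True] by blast
    obtain s where s: "\<And>n. simple_function borel (s n)" "\<And>t. (\<lambda>n. s n t) \<longlonglongrightarrow> f t" "L2_tendsto x s f"
      using simple_L2_dense[OF f True] by blast
    have "e k y = f (m k) *\<^sub>R e k x" if k: "k \<in> K" for k
    proof (rule LIMSEQ_unique)
      show "(\<lambda>n. e k (simple_spectral_integral E (s n) x)) \<longlonglongrightarrow> e k y"
        by (intro bounded_linear.tendsto[OF bounded_linear_e[OF k]] y(2) s)
      show "(\<lambda>n. e k (simple_spectral_integral E (s n) x)) \<longlonglongrightarrow> f (m k) *\<^sub>R e k x"
        using s(2) by (simp add: e_simple s(1) k tendsto_scaleR)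
    qed
    then have "discrete_operator K (f \<circ> m) e x = Some y"
      by (simp add: discrete_operator_eq_Some_iff)
    then show ?thesis
      using y(1) by simp
  next
    \<comment> \<open>The domains must also agree: a sum \<open>y\<close> of the series would bound
      the integrals of all simple functions below \<open>(f t)\<^sup>2\<close>, and \<open>f\<close>
      would be square integrable.\<close>
    case False
    have "discrete_operator K (f \<circ> m) e x \<noteq> Some y" for y
    proof
      assume "discrete_operator K (f \<circ> m) e x = Some y"
      then have y: "\<And>k. k \<in> K \<Longrightarrow> e k y = f (m k) *\<^sub>R e k x"
        by (simp add: discrete_operator_eq_Some_iff)
      have "(\<integral>\<^sup>+t. ennreal ((f t)\<^sup>2) \<partial>distribution x) \<le> ennreal ((norm y)\<^sup>2)"
        unfolding nn_integral_def_finite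
      proof (rule SUP_least, safe)
        fix g :: "real \<Rightarrow> ennreal"
        assume g: "simple_function (distribution x) g" "g \<le> (\<lambda>t. ennreal ((f t)\<^sup>2))" "\<forall>t. g t < top"
        \<comment> \<open>Since \<open>g\<close> takes finite values, its square root is a real
          simple function whose spectral integral can be compared with \<open>y\<close>
          componentwise.\<close>
        define s where "s = (\<lambda>t. sqrt (enn2real (g t)))"
        have "simple_function borel g"
          using g(1) by (simp add: simple_function_def)
        then have s: "simple_function borel s"
          unfolding s_def by (rule simple_function_compose1)
        have s2: "ennreal ((s t)\<^sup>2) = g t" for t
          using g(3) by (simp add: s_def)
        have s_le: "\<bar>s t\<bar> \<le> \<bar>f t\<bar>" for t
        proof -
          have "ennreal ((s t)\<^sup>2) \<le> ennreal ((f t)\<^sup>2)"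
            using g(2) by (simp add: s2 le_fun_def)
          then show ?thesis
            by (simp add: abs_le_square_iff)
        qed
        have "norm (simple_spectral_integral E s x) \<le> norm y"
        proof (rule norm_leI)
          fix k assume "k \<in> K"
          then show "norm (e k (simple_spectral_integral E s x)) \<le> norm (e k y)"
            using mult_right_mono[OF s_le norm_ge_zero, of "m k" "e k x"] by (simp add: e_simple s y)
        qed
        then have "ennreal ((norm (simple_spectral_integral E s x))\<^sup>2) \<le> ennreal ((norm y)\<^sup>2)"
          by (simp add: ennreal_leI power_mono)
        then show "integral\<^sup>S (distribution x) g \<le> ennreal ((norm y)\<^sup>2)"
          by (simp add: norm_simple_spectral_integral[OF s] s2 nn_integral_eq_simple_integral[OF g(1)])
      qed
      then show False
        using False by (simp add: le_less_trans[OF _ ennreal_less_top])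
    qed
    then show ?thesis
      using spectral_integral_eq_None[OF False] by (cases "discrete_operator K (f \<circ> m) e x") auto
  qed
qed

text \<open>
  Uniqueness of the spectral measure follows here without the spectral theorem, as the eigenvectors
  of the operator are total.
\<close>

lemma spectral_measure_eq_proj:
  assumes E: "spectral_measure E" and T: "spectral_integral E (\<lambda>t. t) = discrete_operator K m e"
    and A: "A \<in> sets borel"
  shows "E A x = proj (m -` A) x"
proof -
  interpret spectral E using E by unfold_locales
  have E_e: "E A (e k x) = indicator (m -` A) k *\<^sub>R e k x" if k: "k \<in> K" for k
  proof -
    have *: "E {m k} (e k x) = e k x"
      by (rule eigenvector) (simp add: T discrete_operator_e[OF k])
    then have "E A (e k x) = E (A \<inter> {m k}) (e k x)"
      using Int[OF A, of "{m k}" "e k x"] by simp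
    then show ?thesis
      using * by (cases "m k \<in> A") (simp_all add: empty)
  qed
  have "((\<lambda>k. E A (e k x)) has_sum E A x) K"
    by (rule has_sum_bounded_linear[OF bounded_linear_orthogonal_projection[OF orthogonal_projection[OF A]]
          has_sum_e])
  then have sum: "((\<lambda>k. indicator (m -` A) k *\<^sub>R e k x) has_sum E A x) K"
    by (simp add: E_e cong: has_sum_cong)
  show ?thesis
    by (rule eqI) (use sum in \<open>simp add: has_sum_scaled_iff e_proj\<close>)
qed

lemma borel_calculus_discrete_operator:
  assumes "f \<in> borel_measurable borel"
  shows "borel_calculus f (discrete_operator K m e) = discrete_operator K (f \<circ> m) e"
proof -
  let ?E = "spectral_measure_of (discrete_operator K m e)"
  have "spectral_integral (\<lambda>A. proj (m -` A)) (\<lambda>t. t) = discrete_operator K m e"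
    using spectral_integral_proj[OF spectral_measure_proj, where m = m and f = "\<lambda>t. t"] by (simp add: o_def)
  then have "spectral_measure ?E \<and> spectral_integral ?E (\<lambda>t. t) = discrete_operator K m e"
    unfolding spectral_measure_of_def using spectral_measure_proj
    by (intro someI[of "\<lambda>E. spectral_measure E \<and> spectral_integral E (\<lambda>t. t) = discrete_operator K m e"]) blast
  then show ?thesis
    unfolding borel_calculus_def using assms spectral_measure_eq_proj spectral_integral_proj by metis
qed

section \<open>Borel functions of discrete statistics and weak sufficiency\<close>

lemma borel_measurable_countable_support:
  fixes f :: "real \<Rightarrow> real"
  assumes "countable A" "\<And>t. t \<notin> A \<Longrightarrow> f t = 0"
  shows "f \<in> borel_measurable borel"
proof -
  have "(\<lambda>_. 0) \<in> borel_measurable (borel :: real measure)" by simp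
  then show ?thesis
    by (rule measurable_discrete_difference[where X = A]) (use assms in auto)
qed

lemma discrete_operator_factor:
  assumes "\<And>j k. j \<in> K \<Longrightarrow> k \<in> K \<Longrightarrow> m j = m k \<Longrightarrow> s j = s k"
  shows "\<exists>g\<in>borel_measurable borel. discrete_operator K s e = borel_calculus g (discrete_operator K m e)"
proof
  let ?g = "\<lambda>t. if t \<in> m ` K then s (inv_into K m t) else 0"
  show meas: "?g \<in> borel_measurable borel"
    by (rule borel_measurable_countable_support[of "m ` K"]) (auto simp: countable_K)
  show "discrete_operator K s e = borel_calculus ?g (discrete_operator K m e)"
    unfolding borel_calculus_discrete_operator[OF meas]
    by (intro discrete_operator_cong) (auto intro!: assms inv_into_into simp: f_inv_into_f)
qed

lemma weakly_sufficient_discrete_operator: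
  "weakly_sufficient (discrete_operator K m e) \<Theta> \<phi> \<longleftrightarrow>
   (\<exists>a v \<psi>. \<forall>\<theta>\<in>\<Theta>. is_version (\<psi> \<theta>) (\<phi> \<theta>) \<and> (\<forall>k\<in>K. e k (\<psi> \<theta>) = a \<theta> (m k) *\<^sub>R e k v))"
  (is "_ \<longleftrightarrow> (\<exists>a v \<psi>. ?Q a v \<psi>)")
proof
  assume "weakly_sufficient (discrete_operator K m e) \<Theta> \<phi>"
  then obtain f v \<psi> where f: "\<forall>\<theta>\<in>\<Theta>. f \<theta> \<in> borel_measurable borel \<and> is_version (\<psi> \<theta>) (\<phi> \<theta>) \<and>
      borel_calculus (f \<theta>) (discrete_operator K m e) v = Some (\<psi> \<theta>)"
    unfolding weakly_sufficient_def by blast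
  then have "discrete_operator K (f \<theta> \<circ> m) e v = Some (\<psi> \<theta>)" if "\<theta> \<in> \<Theta>" for \<theta>
    using that by (metis borel_calculus_discrete_operator)
  then have "e k (\<psi> \<theta>) = f \<theta> (m k) *\<^sub>R e k v" if "\<theta> \<in> \<Theta>" "k \<in> K" for \<theta> k
    using that by (simp add: discrete_operator_eq_Some_iff)
  then have "?Q f v \<psi>"
    using f by blast
  then show "\<exists>a v \<psi>. ?Q a v \<psi>" by blast
next
  assume "\<exists>a v \<psi>. ?Q a v \<psi>"
  then obtain a v \<psi> where Q: "?Q a v \<psi>" by blast
  let ?f = "\<lambda>\<theta> t. if t \<in> m ` K then a \<theta> t else 0"
  have f: "?f \<theta> \<in> borel_measurable borel" for \<theta>
    by (rule borel_measurable_countable_support[of "m ` K"]) (auto simp: countable_K)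
  have "borel_calculus (?f \<theta>) (discrete_operator K m e) v = Some (\<psi> \<theta>)" if "\<theta> \<in> \<Theta>" for \<theta>
    unfolding borel_calculus_discrete_operator[OF f] using Q that by (simp add: discrete_operator_eq_Some_iff)
  then show "weakly_sufficient (discrete_operator K m e) \<Theta> \<phi>"
    unfolding weakly_sufficient_def using f Q selfadjoint_discrete_operator
    by (intro conjI exI[of _ ?f] exI[of _ v] exI[of _ \<psi>]) auto
qed

lemma affiliated_discrete_operator:
  assumes "affiliated U (discrete_operator K m e)"
  obtains g where "g \<in> borel_measurable borel" "U = discrete_operator K (g \<circ> m) e"
  using assms by (auto simp: affiliated_def borel_calculus_discrete_operator)

end


section \<open>Minimal weakly sufficient statistics\<close>

lemma is_version_sym:
  assumes "is_version w v"
  shows "is_version v (w::'a::complex_inner)"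
proof -
  obtain c where c: "cmod c = 1" "w = c *\<^sub>C v"
    using assms by (auto simp: is_version_def)
  then have "c \<noteq> 0" by auto
  then have "cmod (inverse c) = 1" "v = inverse c *\<^sub>C w"
    using c by (simp_all add: norm_inverse)
  then show ?thesis
    unfolding is_version_def by blast
qed

lemma is_version_trans:
  assumes "is_version u v" "is_version v w"
  shows "is_version u (w::'a::complex_inner)"
proof -
  obtain c d where "cmod c = 1" "u = c *\<^sub>C v" "cmod d = 1" "v = d *\<^sub>C w"
    using assms by (auto simp: is_version_def)
  then have "cmod (c * d) = 1" "u = (c * d) *\<^sub>C w"
    by (simp_all add: norm_mult)
  then show ?thesis
    unfolding is_version_def by blast
qed

lemma is_version_norm: "is_version w v \<Longrightarrow> norm w = norm (v::'a::complex_inner)"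
  by (auto simp: is_version_def norm_scaleC)

text \<open>
  Both \<open>x'\<close> and \<open>y'\<close> are non-zero complex multiples of \<open>x\<close> and \<open>y\<close>, which makes \<open>p\<close> and \<open>p'\<close>
  complex multiples of each other; as they are real, the ratio can be taken real.
\<close>

lemma real_proportional:
  fixes x y x' y' :: "'a::complex_inner" and p p' q :: "'i \<Rightarrow> real"
  assumes x: "\<And>\<theta>. \<theta> \<in> \<Theta> \<Longrightarrow> d \<theta> *\<^sub>C p \<theta> *\<^sub>R x = q \<theta> *\<^sub>R x'"
    and y: "\<And>\<theta>. \<theta> \<in> \<Theta> \<Longrightarrow> d \<theta> *\<^sub>C p' \<theta> *\<^sub>R y = q \<theta> *\<^sub>R y'"
    and d: "\<And>\<theta>. \<theta> \<in> \<Theta> \<Longrightarrow> d \<theta> \<noteq> 0" and "x \<noteq> 0" "y \<noteq> 0"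
    and "\<exists>\<theta>\<in>\<Theta>. p \<theta> \<noteq> 0" "\<exists>\<theta>\<in>\<Theta>. p' \<theta> \<noteq> 0"
  shows "\<exists>r. \<forall>\<theta>\<in>\<Theta>. p \<theta> = r * p' \<theta>"
proof -
  have multiple: "\<exists>\<gamma>. \<forall>\<theta>\<in>\<Theta>. d \<theta> * complex_of_real (p \<theta>) = complex_of_real (q \<theta>) * \<gamma>"
    if x: "\<And>\<theta>. \<theta> \<in> \<Theta> \<Longrightarrow> d \<theta> *\<^sub>C p \<theta> *\<^sub>R x = q \<theta> *\<^sub>R x'" and "x \<noteq> 0" and p: "\<exists>\<theta>\<in>\<Theta>. p \<theta> \<noteq> 0"
    for p :: "'i \<Rightarrow> real" and x x' :: 'a
  proof -
    obtain \<theta>\<^sub>0 where \<theta>\<^sub>0: "\<theta>\<^sub>0 \<in> \<Theta>" "p \<theta>\<^sub>0 \<noteq> 0" using p by blast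
    \<comment> \<open>The factor with \<open>x' = \<gamma> *\<^sub>C x\<close>, solved from the
      equation at \<open>\<theta>\<^sub>0\<close>, where both sides are non-zero.\<close>
    define \<gamma> where "\<gamma> = complex_of_real (inverse (q \<theta>\<^sub>0)) * (d \<theta>\<^sub>0 * complex_of_real (p \<theta>\<^sub>0))"
    have "q \<theta>\<^sub>0 *\<^sub>R x' \<noteq> 0"
      using x[OF \<theta>\<^sub>0(1)] \<theta>\<^sub>0 d \<open>x \<noteq> 0\<close> by (metis complex_vector.scale_eq_0_iff scaleR_eq_0_iff)
    then have "x' = inverse (q \<theta>\<^sub>0) *\<^sub>R q \<theta>\<^sub>0 *\<^sub>R x'"
      by simp
    also have "\<dots> = \<gamma> *\<^sub>C x"
      unfolding x[OF \<theta>\<^sub>0(1), symmetric] \<gamma>_def by (simp add: scaleR_scaleC scaleC_scaleC)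
    finally have x': "x' = \<gamma> *\<^sub>C x" .
    have "d \<theta> * complex_of_real (p \<theta>) = complex_of_real (q \<theta>) * \<gamma>" if "\<theta> \<in> \<Theta>" for \<theta>
      using x[OF that] \<open>x \<noteq> 0\<close> by (simp add: x' scaleR_scaleC)
    then show ?thesis by blast
  qed
  obtain \<gamma> where \<gamma>: "\<And>\<theta>. \<theta> \<in> \<Theta> \<Longrightarrow> d \<theta> * complex_of_real (p \<theta>) = complex_of_real (q \<theta>) * \<gamma>"
    using multiple[OF x] assms by blast
  obtain \<delta> where \<delta>: "\<And>\<theta>. \<theta> \<in> \<Theta> \<Longrightarrow> d \<theta> * complex_of_real (p' \<theta>) = complex_of_real (q \<theta>) * \<delta>"
    using multiple[OF y] assms by blast
  have "\<delta> \<noteq> 0"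
    using \<delta> d assms(7) by force
  define \<rho> where "\<rho> = \<gamma> / \<delta>"
  have "p \<theta> = Re \<rho> * p' \<theta>" if \<theta>: "\<theta> \<in> \<Theta>" for \<theta>
  proof -
    have "d \<theta> * (complex_of_real (p \<theta>) * \<delta>) = d \<theta> * (complex_of_real (p' \<theta>) * \<gamma>)"
      using \<gamma>[OF \<theta>] \<delta>[OF \<theta>] by (metis mult.assoc mult.left_commute mult.commute)
    then have "complex_of_real (p \<theta>) = \<rho> * complex_of_real (p' \<theta>)"
      using d[OF \<theta>] \<open>\<delta> \<noteq> 0\<close> by (simp add: \<rho>_def field_simps)
    from arg_cong[OF this, of Re] show ?thesis
      by simp
  qed
  then show ?thesis by blast
qed

context identity_partition
begin

text \<open>The witnesses of weak sufficiency are kept explicit so that the descriptions by two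
  statistics can be compared.\<close>

definition coordinates :: "'i set \<Rightarrow> ('i \<Rightarrow> 'a) \<Rightarrow> ('k \<Rightarrow> real) \<Rightarrow> ('i \<Rightarrow> real \<Rightarrow> real) \<Rightarrow> 'a \<Rightarrow> ('i \<Rightarrow> 'a) \<Rightarrow> bool" where
  "coordinates \<Theta> \<phi> m a v \<psi> \<longleftrightarrow>
     (\<forall>\<theta>\<in>\<Theta>. is_version (\<psi> \<theta>) (\<phi> \<theta>) \<and> (\<forall>k\<in>K. e k (\<psi> \<theta>) = a \<theta> (m k) *\<^sub>R e k v))"

lemma weakly_sufficient_iff_coordinates:
  "weakly_sufficient (discrete_operator K m e) \<Theta> \<phi> \<longleftrightarrow> (\<exists>a v \<psi>. coordinates \<Theta> \<phi> m a v \<psi>)"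
  by (simp add: coordinates_def weakly_sufficient_discrete_operator)

lemma e_version_eq_0_iff:
  assumes "is_version w v" "k \<in> K"
  shows "e k w = 0 \<longleftrightarrow> e k v = 0"
proof -
  obtain c where "cmod c = 1" "w = c *\<^sub>C v" using assms(1) by (auto simp: is_version_def)
  then show ?thesis using assms(2) by (auto simp: e_scaleC)
qed

text \<open>Weak sufficiency puts all the components \<open>e k (\<phi> \<theta>)\<close> on the
  complex line through \<open>e k v\<close>.\<close>

lemma cdim_component_eq_1_iff:
  assumes "coordinates \<Theta> \<phi> m a v \<psi>" "k \<in> K"
  shows "cdim (ccspan ((\<lambda>\<theta>. e k (\<phi> \<theta>)) ` \<Theta>)) = 1 \<longleftrightarrow> (\<exists>\<theta>\<in>\<Theta>. e k (\<phi> \<theta>) \<noteq> 0)"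
proof -
  have "e k (\<phi> \<theta>) \<in> range (\<lambda>c. c *\<^sub>C e k v)" if "\<theta> \<in> \<Theta>" for \<theta>
  proof -
    have "is_version (\<phi> \<theta>) (\<psi> \<theta>)" "e k (\<psi> \<theta>) = a \<theta> (m k) *\<^sub>R e k v"
      using assms that is_version_sym by (auto simp: coordinates_def)
    moreover obtain c where "\<phi> \<theta> = c *\<^sub>C \<psi> \<theta>"
      using calculation(1) by (auto simp: is_version_def)
    ultimately have "e k (\<phi> \<theta>) = (c * complex_of_real (a \<theta> (m k))) *\<^sub>C e k v"
      using assms(2) by (simp add: e_scaleC scaleR_scaleC)
    then show ?thesis by blast
  qed
  then have "(\<lambda>\<theta>. e k (\<phi> \<theta>)) ` \<Theta> \<subseteq> range (\<lambda>c. c *\<^sub>C e k v)"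
    by blast
  from cdim_ccspan_eq_1_iff[OF this] show ?thesis by simp
qed

section \<open>Necessity of non-zero components\<close>

text \<open>A scalar statistic yields only multiples of \<open>v\<close>, so all states lie on one
  complex line.\<close>

lemma weakly_sufficient_const_imp_trivial:
  assumes "weakly_sufficient (discrete_operator K s e) \<Theta> \<phi>" and s: "\<And>k. k \<in> K \<Longrightarrow> s k = r"
  shows "\<not> nontrivial_family \<Theta> \<phi>"
proof -
  obtain a v \<psi> where C: "coordinates \<Theta> \<phi> s a v \<psi>"
    using assms weakly_sufficient_iff_coordinates by blast
  have "\<phi> \<theta> \<in> range (\<lambda>c. c *\<^sub>C v)" if "\<theta> \<in> \<Theta>" for \<theta>
  proof -
    have "\<psi> \<theta> = a \<theta> r *\<^sub>R v"
      using C that s by (intro eqI[of "\<psi> \<theta>"]) (simp add: coordinates_def e_scaleR)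
    moreover have "is_version (\<phi> \<theta>) (\<psi> \<theta>)"
      using C that is_version_sym by (auto simp: coordinates_def)
    ultimately obtain c where "\<phi> \<theta> = (c * complex_of_real (a \<theta> r)) *\<^sub>C v"
      by (auto simp: is_version_def scaleR_scaleC)
    then show ?thesis by blast
  qed
  then have "cdim (ccspan (\<phi> ` \<Theta>)) \<le> 1"
    by (intro cdim_ccspan_le_1) blast
  then show ?thesis
    unfolding nontrivial_family_def by (meson not_le one_less_numeral_iff order.strict_trans1 semiring_norm(76))
qed

text \<open>
  If all states vanish on the range of \<open>e k\<^sub>0\<close>, the eigenvalue of \<open>k\<^sub>0\<close> can be merged with any other
  one without losing weak sufficiency, which forces a minimal statistic to be scalar.
\<close>

lemma minimal_imp_component_nonzero:
  assumes inj: "inj_on l K" and nontrivial: "nontrivial_family \<Theta> \<phi>"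
    and sufficient: "weakly_sufficient (discrete_operator K l e) \<Theta> \<phi>"
    and min: "minimal_weakly_sufficient S (discrete_operator K l e) \<Theta> \<phi>" and k\<^sub>0: "k\<^sub>0 \<in> K"
  shows "\<exists>\<theta>\<in>\<Theta>. e k\<^sub>0 (\<phi> \<theta>) \<noteq> 0"
proof (rule ccontr)
  assume "\<not> ?thesis"
  then have zero: "e k\<^sub>0 (\<phi> \<theta>) = 0" if "\<theta> \<in> \<Theta>" for \<theta> using that by blast
  obtain a v \<psi> where C: "coordinates \<Theta> \<phi> l a v \<psi>"
    using sufficient weakly_sufficient_iff_coordinates by blast
  have factor: "\<exists>g. S = discrete_operator K (g \<circ> f \<circ> l) e"
    if f: "f \<in> borel_measurable borel" and ws: "weakly_sufficient (discrete_operator K (f \<circ> l) e) \<Theta> \<phi>" for f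
  proof -
    have "affiliated (discrete_operator K (f \<circ> l) e) (discrete_operator K l e)"
      unfolding affiliated_def using f borel_calculus_discrete_operator[OF f, of l] by metis
    then obtain g where "g \<in> borel_measurable borel" "S = borel_calculus g (discrete_operator K (f \<circ> l) e)"
      using min ws by (auto simp: minimal_weakly_sufficient_def)
    then show ?thesis
      by (auto simp: borel_calculus_discrete_operator o_assoc)
  qed
  \<comment> \<open>The identity function, that is, \<open>T\<close> compared with itself, shows
    that \<open>S\<close> is a function of \<open>T\<close>.\<close>
  have "\<exists>g. S = discrete_operator K (g \<circ> (\<lambda>t. t) \<circ> l) e"
    by (rule factor) (use sufficient in \<open>simp_all add: o_def\<close>)
  then obtain g where S: "S = discrete_operator K (\<lambda>k. g (l k)) e"
    by (auto simp: o_def)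
  have "g (l k\<^sub>1) = g (l k\<^sub>0)" if k\<^sub>1: "k\<^sub>1 \<in> K" for k\<^sub>1
  proof (cases "k\<^sub>1 = k\<^sub>0")
    case False
    \<comment> \<open>Moves the eigenvalue of \<open>k\<^sub>0\<close> to that of
      \<open>k\<^sub>1\<close> and, by injectivity of \<open>l\<close>, fixes the eigenvalues of all
      other indices.\<close>
    define f where "f = (\<lambda>t. if t = l k\<^sub>0 then l k\<^sub>1 else t)"
    have meas: "f \<in> borel_measurable borel"
      unfolding f_def by measurable
    have f: "f (l k) = l k" if "k \<in> K" "k \<noteq> k\<^sub>0" for k
      using that inj k\<^sub>0 by (auto simp: f_def inj_on_def)
    \<comment> \<open>The \<open>k\<^sub>0\<close> component is removed from \<open>v\<close>
      because \<open>a \<theta> (l k\<^sub>1)\<close>, now its coefficient, may be non-zero while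
      the states vanish there.\<close>
    have "e k (\<psi> \<theta>) = a \<theta> (f (l k)) *\<^sub>R e k (v - e k\<^sub>0 v)" if "\<theta> \<in> \<Theta>" "k \<in> K" for \<theta> k
    proof (cases "k = k\<^sub>0")
      case True
      then have "e k (\<psi> \<theta>) = 0"
        using e_version_eq_0_iff[of "\<psi> \<theta>" "\<phi> \<theta>" k] zero C that by (simp add: coordinates_def)
      then show ?thesis
        using True that by (simp add: linear_diff[OF bounded_linear.linear[OF bounded_linear_e]] e_e)
    next
      case False
      then show ?thesis
        using C that k\<^sub>0 by (simp add: linear_diff[OF bounded_linear.linear[OF bounded_linear_e]] e_e f coordinates_def)
    qed
    then have "coordinates \<Theta> \<phi> (f \<circ> l) a (v - e k\<^sub>0 v) \<psi>"
      using C by (simp add: coordinates_def)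
    then have "weakly_sufficient (discrete_operator K (f \<circ> l) e) \<Theta> \<phi>"
      using weakly_sufficient_iff_coordinates by blast
    then obtain h where "S = discrete_operator K (h \<circ> f \<circ> l) e"
      using factor[OF meas] by blast
    then have "g (l k) = h (f (l k))" if "k \<in> K" for k
      using discrete_operator_inject[of "\<lambda>k. g (l k)" "h \<circ> f \<circ> l" k] S that by simp
    then show ?thesis
      using k\<^sub>0 k\<^sub>1 f[OF k\<^sub>1 False] by (simp add: f_def)
  qed simp
  then have "\<not> nontrivial_family \<Theta> \<phi>"
    using min S by (intro weakly_sufficient_const_imp_trivial[of "\<lambda>k. g (l k)" _ _ "g (l k\<^sub>0)"])
      (simp_all add: minimal_weakly_sufficient_def)
  then show False using nontrivial by blast
qed

section \<open>Proportional coordinates and the minimal statistic\<close>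

text \<open>The two choices of versions differ by factors \<open>d \<theta>\<close> that are the
  same at \<open>j\<close> and \<open>k\<close>, and \<open>m j = m k\<close> makes the coefficients
  \<open>a' \<theta> (m j)\<close> and \<open>a' \<theta> (m k)\<close> coincide. This common
  coefficient is the \<open>q\<close> of \<open>real_proportional\<close>.\<close>

lemma coordinates_proportional:
  assumes C: "coordinates \<Theta> \<phi> l a v \<psi>" and C': "coordinates \<Theta> \<phi> m a' v' \<psi>'"
    and nz: "\<And>k. k \<in> K \<Longrightarrow> \<exists>\<theta>\<in>\<Theta>. e k (\<phi> \<theta>) \<noteq> 0"
    and jk: "j \<in> K" "k \<in> K" "m j = m k"
  shows "\<exists>r. \<forall>\<theta>\<in>\<Theta>. a \<theta> (l j) = r * a \<theta> (l k)"
proof -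
  have "\<exists>c. c \<noteq> 0 \<and> \<psi>' \<theta> = c *\<^sub>C \<psi> \<theta>" if "\<theta> \<in> \<Theta>" for \<theta>
  proof -
    have "is_version (\<psi>' \<theta>) (\<psi> \<theta>)"
      using C C' that is_version_sym is_version_trans by (metis coordinates_def)
    then show ?thesis
      by (metis is_version_def norm_zero zero_neq_one)
  qed
  then obtain d where d: "\<And>\<theta>. \<theta> \<in> \<Theta> \<Longrightarrow> d \<theta> \<noteq> 0 \<and> \<psi>' \<theta> = d \<theta> *\<^sub>C \<psi> \<theta>"
    by metis
  have eq: "d \<theta> *\<^sub>C a \<theta> (l i) *\<^sub>R e i v = a' \<theta> (m i) *\<^sub>R e i v'" if "\<theta> \<in> \<Theta>" "i \<in> K" for \<theta> i
  proof -
    have "e i (\<psi>' \<theta>) = d \<theta> *\<^sub>C e i (\<psi> \<theta>)"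
      using that d by (simp add: e_scaleC)
    then show ?thesis
      using C C' that by (simp add: coordinates_def)
  qed
  have nonzero: "e i v \<noteq> 0 \<and> (\<exists>\<theta>\<in>\<Theta>. a \<theta> (l i) \<noteq> 0)" if i: "i \<in> K" for i
  proof -
    obtain \<theta> where \<theta>: "\<theta> \<in> \<Theta>" "e i (\<phi> \<theta>) \<noteq> 0" using nz[OF i] by blast
    then have "e i (\<psi> \<theta>) \<noteq> 0" "e i (\<psi> \<theta>) = a \<theta> (l i) *\<^sub>R e i v"
      using C i e_version_eq_0_iff[of "\<psi> \<theta>" "\<phi> \<theta>" i] by (simp_all add: coordinates_def)
    then show ?thesis using \<theta>(1) by auto
  qed
  show ?thesis
    by (rule real_proportional[where d = d and x = "e j v" and x' = "e j v'" and y = "e k v" and y' = "e k v'"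
          and q = "\<lambda>\<theta>. a' \<theta> (m k)"])
       (use eq jk d nonzero in \<open>force+\<close>)
qed

lemma ex_minimal:
  assumes sufficient: "weakly_sufficient (discrete_operator K l e) \<Theta> \<phi>"
    and states: "\<And>\<theta>. \<theta> \<in> \<Theta> \<Longrightarrow> vector_state (\<phi> \<theta>)"
    and nz: "\<And>k. k \<in> K \<Longrightarrow> \<exists>\<theta>\<in>\<Theta>. e k (\<phi> \<theta>) \<noteq> 0"
  shows "\<exists>S. minimal_weakly_sufficient S (discrete_operator K l e) \<Theta> \<phi>"
proof -
  obtain a v \<psi> where C: "coordinates \<Theta> \<phi> l a v \<psi>"
    using sufficient weakly_sufficient_iff_coordinates by blast
  define b where "b k \<theta> = a \<theta> (l k)" for k \<theta>
  have b: "e k (\<psi> \<theta>) = b k \<theta> *\<^sub>R e k v" if "k \<in> K" "\<theta> \<in> \<Theta>" for k \<theta>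
    using C that by (simp add: b_def coordinates_def)
  have "\<exists>\<theta>\<in>\<Theta>. b k \<theta> \<noteq> 0" if k: "k \<in> K" for k
  proof -
    obtain \<theta> where \<theta>: "\<theta> \<in> \<Theta>" "e k (\<phi> \<theta>) \<noteq> 0" using nz[OF k] by blast
    then have "e k (\<psi> \<theta>) \<noteq> 0"
      using C k e_version_eq_0_iff[of "\<psi> \<theta>" "\<phi> \<theta>" k] by (simp add: coordinates_def)
    then show ?thesis using \<theta>(1) b[OF k] by auto
  qed
  then obtain \<tau> where \<tau>: "\<And>k. k \<in> K \<Longrightarrow> \<tau> k \<in> \<Theta>" "\<And>k. k \<in> K \<Longrightarrow> b k (\<tau> k) \<noteq> 0"
    by metis
  define R where "R j k \<longleftrightarrow> (\<exists>r. \<forall>\<theta>\<in>\<Theta>. b j \<theta> = r * b k \<theta>)" for j k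
  have R_refl: "R k k" for k
    unfolding R_def by (intro exI[of _ 1]) simp
  \<comment> \<open>A zero function would be proportional to every other; symmetry holds because
    \<open>b j\<close> does not vanish at \<open>\<tau> j\<close>.\<close>
  have R_sym: "R k j" if jk: "R j k" "j \<in> K" for j k
  proof -
    obtain r where r: "\<And>\<theta>. \<theta> \<in> \<Theta> \<Longrightarrow> b j \<theta> = r * b k \<theta>" using jk(1) by (auto simp: R_def)
    have "r \<noteq> 0" using r[OF \<tau>(1)[OF jk(2)]] \<tau>(2)[OF jk(2)] by auto
    then show ?thesis
      unfolding R_def using r by (intro exI[of _ "inverse r"]) simp
  qed
  have R_trans: "R i k" if "R i j" "R j k" for i j k
  proof -
    obtain r where "\<And>\<theta>. \<theta> \<in> \<Theta> \<Longrightarrow> b i \<theta> = r * b j \<theta>"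
      using \<open>R i j\<close> by (auto simp: R_def)
    moreover obtain r' where "\<And>\<theta>. \<theta> \<in> \<Theta> \<Longrightarrow> b j \<theta> = r' * b k \<theta>"
      using \<open>R j k\<close> by (auto simp: R_def)
    ultimately show ?thesis
      unfolding R_def by (intro exI[of _ "r * r'"]) simp
  qed
  \<comment> \<open>The choice depends on \<open>k\<close> only through its class, so equivalent
    indices get equal representatives.\<close>
  define rep where "rep k = (SOME j. j \<in> K \<and> R j k)" for k
  have rep: "rep k \<in> K \<and> R (rep k) k" if "k \<in> K" for k
    unfolding rep_def by (rule someI[of _ k]) (use that R_refl in simp)
  have rep_eq: "rep j = rep k" if "R j k" "j \<in> K" for j k
  proof -
    have "(i \<in> K \<and> R i j) = (i \<in> K \<and> R i k)" for i
      using that R_sym R_trans by blast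
    then show ?thesis by (simp add: rep_def)
  qed
  \<comment> \<open>Classes are numbered by the position of their representative in
    \<open>K\<close>; the number determines the representative.\<close>
  define N where "N k = to_nat_on K (rep k)" for k
  define s where "s k = real (N k)" for k
  have from_N: "from_nat_into K (N k) = rep k" if "k \<in> K" for k
    using that rep countable_K by (simp add: N_def)
  have s_eq: "s j = s k" if "R j k" "j \<in> K" for j k
    using rep_eq[OF that] by (simp add: s_def N_def)
  \<comment> \<open>For the class number \<open>n\<close> with representative \<open>j\<close>, this
    is the class component of \<open>\<psi> (\<tau> j)\<close>. The weights make the series over all
    classes summable, as the states are unit vectors.\<close>
  define w where "w n = proj {k. N k = n} ((1/2) ^ n *\<^sub>R \<psi> (\<tau> (from_nat_into K n)))" for n
  have "summable w"
  \<comment> \<open>For empty \<open>K\<close>, \<open>from_nat_into K n\<close> need not supply an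
    index at which \<open>\<tau>\<close> is controlled.\<close>
  proof (cases "K = {}")
    case True
    then have "w n = 0" for n
      using eqI[of "w n" 0] by simp
    then have "w = (\<lambda>_. 0)" by blast
    then show ?thesis by simp
  next
    case False
    have "norm (w n) \<le> (1/2) ^ n" for n
    proof -
      have "\<tau> (from_nat_into K n) \<in> \<Theta>"
        using \<tau>(1) from_nat_into[OF False] by blast
      then have "norm (\<psi> (\<tau> (from_nat_into K n))) = 1"
        using C states is_version_norm by (metis coordinates_def vector_state_def)
      then show ?thesis
        unfolding w_def
        using orthogonal_projection_norm_le[OF orthogonal_projection_proj,
            of "{k. N k = n}" "(1/2) ^ n *\<^sub>R \<psi> (\<tau> (from_nat_into K n))"] by simp
    qed
    then show ?thesis
      by (rule summable_comparison_test'[OF summable_geometric, of "1/2" 0, rotated]) simp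
  qed
  then have w_sums: "w sums suminf w" by (rule summable_sums)
  have e_w: "e k (suminf w) = ((1/2) ^ N k * b k (\<tau> (rep k))) *\<^sub>R e k v" if k: "k \<in> K" for k
  proof -
    have "e k (w n) = (if n = N k then ((1/2) ^ n * b k (\<tau> (rep k))) *\<^sub>R e k v else 0)" for n
      using k rep \<tau>(1) by (auto simp: w_def e_proj e_scaleR from_N b)
    then have "(\<lambda>n. e k (w n)) sums (((1/2) ^ N k * b k (\<tau> (rep k))) *\<^sub>R e k v)"
      using sums_single[of "N k" "\<lambda>n. ((1/2) ^ n * b k (\<tau> (rep k))) *\<^sub>R e k v"] by simp
    then show ?thesis
      using bounded_linear.sums[OF bounded_linear_e[OF k] w_sums] sums_unique2 by blast
  qed
  \<comment> \<open>Rounding recovers the class number from \<open>t = s k\<close>, and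
    \<open>2 ^ n\<close> cancels the weight. The quotient formed at the representative equals the
    one at \<open>k\<close>, since the proportionality factor cancels.\<close>
  define c where "c \<theta> t = 2 ^ nat \<lfloor>t\<rfloor> * b (from_nat_into K (nat \<lfloor>t\<rfloor>)) \<theta> /
      b (from_nat_into K (nat \<lfloor>t\<rfloor>)) (\<tau> (from_nat_into K (nat \<lfloor>t\<rfloor>)))" for \<theta> and t :: real
  have "e k (\<psi> \<theta>) = c \<theta> (s k) *\<^sub>R e k (suminf w)" if k: "k \<in> K" and \<theta>: "\<theta> \<in> \<Theta>" for k \<theta>
  proof -
    have "rep k \<in> K" using rep[OF k] by blast
    obtain r where r: "\<And>\<theta>. \<theta> \<in> \<Theta> \<Longrightarrow> b (rep k) \<theta> = r * b k \<theta>"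
      using rep[OF k] by (auto simp: R_def)
    have "r * b k (\<tau> (rep k)) \<noteq> 0"
      using r \<tau> \<open>rep k \<in> K\<close> by metis
    then have "c \<theta> (s k) * ((1/2) ^ N k * b k (\<tau> (rep k))) = b k \<theta>"
      using r[OF \<theta>] r[OF \<tau>(1)[OF \<open>rep k \<in> K\<close>]] by (simp add: c_def s_def from_N k field_simps power_divide)
    then show ?thesis
      by (simp add: e_w[OF k] b[OF k \<theta>])
  qed
  then have "coordinates \<Theta> \<phi> s c (suminf w) \<psi>"
    using C by (simp add: coordinates_def)
  then have "weakly_sufficient (discrete_operator K s e) \<Theta> \<phi>"
    using weakly_sufficient_iff_coordinates by blast
  moreover have "\<exists>g\<in>borel_measurable borel. discrete_operator K s e = borel_calculus g U"
    if U: "weakly_sufficient U \<Theta> \<phi>" "affiliated U (discrete_operator K l e)" for U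
  proof -
    obtain m where U_eq: "U = discrete_operator K m e"
      using affiliated_discrete_operator[OF U(2)] by metis
    then obtain a' v' \<psi>' where C': "coordinates \<Theta> \<phi> m a' v' \<psi>'"
      using U(1) weakly_sufficient_iff_coordinates by blast
    show ?thesis
      unfolding U_eq
    \<comment> \<open>Indices that \<open>U\<close> identifies have proportional coordinates, hence
      lie in one class and get the same value of \<open>s\<close>.\<close>
    proof (rule discrete_operator_factor)
      fix j k assume "j \<in> K" "k \<in> K" "m j = m k"
      then show "s j = s k"
        using coordinates_proportional[OF C C' nz] by (intro s_eq) (simp_all add: R_def b_def)
    qed
  qed
  ultimately show ?thesis
    unfolding minimal_weakly_sufficient_def by blast
qed

end

theorem theorem5:
  fixes \<phi> :: "'i \<Rightarrow> 'a::chilbert_space" and \<Theta> :: "'i set"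
    and K :: "'k set" and e :: "'k \<Rightarrow> 'a \<Rightarrow> 'a" and l :: "'k \<Rightarrow> real"
    and T :: "'a \<rightharpoonup> 'a"
  assumes separable: "separable_space (euclidean :: 'a topology)"
    and states: "\<forall>\<theta>\<in>\<Theta>. vector_state (\<phi> \<theta>)"
    and nontrivial: "nontrivial_family \<Theta> \<phi>"
    and partition: "partition_of_identity K e"
    and distinct: "inj_on l K"
    and discrete: "T = discrete_operator K l e"
    and sufficient: "weakly_sufficient T \<Theta> \<phi>"
  shows "(\<exists>S. minimal_weakly_sufficient S T \<Theta> \<phi>) \<longleftrightarrow>
         (\<forall>k\<in>K. cdim (ccspan ((\<lambda>\<theta>. e k (\<phi> \<theta>)) ` \<Theta>)) = 1)"
proof -
  interpret identity_partition K e
    using partition by unfold_locales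
  obtain a v \<psi> where C: "coordinates \<Theta> \<phi> l a v \<psi>"
    using sufficient weakly_sufficient_iff_coordinates discrete by blast
  \<comment> \<open>Both implications are proved with non-vanishing components; weak sufficiency of
    \<open>T\<close> then turns these into dimension 1.\<close>
  have "(\<exists>S. minimal_weakly_sufficient S T \<Theta> \<phi>) \<longleftrightarrow> (\<forall>k\<in>K. \<exists>\<theta>\<in>\<Theta>. e k (\<phi> \<theta>) \<noteq> 0)"
    using minimal_imp_component_nonzero[OF distinct nontrivial] ex_minimal states sufficient
    unfolding discrete by blast
  then show ?thesis
    using cdim_component_eq_1_iff[OF C] by simp
qed

end
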